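(* Let $n,h,\lambda,k,r_1,\dots,r_k$ be positive integers with $n>h$, and let $\lambda K_n^h$ denote the hypergraph on an $n$-element vertex set $V$ whose edge multiset consists of exactly $\lambda$ copies of each $h$-element subset of $V$. Then $\lambda K_n^h$ is $(r_1,\dots,r_k)$-factorizable if and only if $h$ divides $r_i n$ for every $1\le i\le k$ and $\sum_{i=1}^k r_i=\lambda\binom{n-1}{h-1}$. Moreover, when these conditions hold, there is an $(r_1,\dots,r_k)$-factorization $F_1,\dots,F_k$ of $\lambda K_n^h$ such that, for every $i$ with $r_i\ge 2$, the $r_i$-factor $F_i$ is a connected hypergraph.
   Context: A hypergraph is a pair $(V,E)$ with $V$ a finite set and $E$ a multiset of edges, each edge a multi-subset of $V$. The degree of a vertex is the total number of occurrences of it among all edges (counted with multiplicity). For a positive integer $r$, an $r$-factor of a hypergraph $\mathcal G$ is a spanning sub-hypergraph (same vertex set, a sub-multiset of the edges) in which every vertex has degree $r$. For positive integers $r_1,\dots,r_k$, an $(r_1,\dots,r_k)$-factorization of $\mathcal G$ is a partition of the edge multiset of $\mathcal G$ into $F_1,\dots,F_k$ such that $(V,F_i)$ is an $r_i$-factor for each $i$. A hypergraph is connected if for any two vertices $u,v$ there is a sequence of vertices $u=v_0,v_1,\dots,v_t=v$ with consecutive vertices lying in a common edge.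
   Formalization: The "Moreover" clause on connected factors is stated only for h ≥ 2, since for h = 1 all edges are singletons and no factor on n ≥ 2 vertices is connected (e.g. n=2, h=1, λ=2, k=1, r_1=2); the equivalence is stated for all h ≥ 1. *)

theory Defs
  imports "HOL-Library.Multiset"
begin

type_synonym 'a hypergraph = "'a set \<times> 'a multiset multiset"

definition is_hypergraph :: "'a hypergraph \<Rightarrow> bool" where
  "is_hypergraph G \<longleftrightarrow> finite (fst G) \<and> (\<forall>e \<in># snd G. set_mset e \<subseteq> fst G)"

definition hdegree :: "'a hypergraph \<Rightarrow> 'a \<Rightarrow> nat" where
  "hdegree G v = (\<Sum>e \<in># snd G. count e v)"

definition spanning_subhypergraph :: "'a hypergraph \<Rightarrow> 'a hypergraph \<Rightarrow> bool" where
  "spanning_subhypergraph H G \<longleftrightarrow>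
     is_hypergraph H \<and> is_hypergraph G \<and> fst H = fst G \<and> snd H \<subseteq># snd G"

definition is_factor :: "nat \<Rightarrow> 'a hypergraph \<Rightarrow> 'a hypergraph \<Rightarrow> bool" where
  "is_factor r H G \<longleftrightarrow> spanning_subhypergraph H G \<and> (\<forall>v \<in> fst G. hdegree H v = r)"

text \<open>The tuples \<open>r\<close> and \<open>F\<close> are indexed by \<open>{1..k}\<close>; their values elsewhere are irrelevant.\<close>

definition is_factorization ::
  "nat \<Rightarrow> (nat \<Rightarrow> nat) \<Rightarrow> (nat \<Rightarrow> 'a multiset multiset) \<Rightarrow> 'a hypergraph \<Rightarrow> bool" where
  "is_factorization k r F G \<longleftrightarrow>
     (\<Sum>i = 1..k. F i) = snd G \<and> (\<forall>i \<in> {1..k}. is_factor (r i) (fst G, F i) G)"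

definition factorizable :: "nat \<Rightarrow> (nat \<Rightarrow> nat) \<Rightarrow> 'a hypergraph \<Rightarrow> bool" where
  "factorizable k r G \<longleftrightarrow> (\<exists>F. is_factorization k r F G)"

definition hconnected :: "'a hypergraph \<Rightarrow> bool" where
  "hconnected G \<longleftrightarrow> (\<forall>u \<in> fst G. \<forall>v \<in> fst G. \<exists>(t :: nat) w.
     w 0 = u \<and> w t = v \<and> (\<forall>j \<le> t. w j \<in> fst G) \<and>
     (\<forall>j < t. \<exists>e \<in># snd G. w j \<in># e \<and> w (Suc j) \<in># e))"

definition complete_hypergraph :: "nat \<Rightarrow> nat \<Rightarrow> 'a set \<Rightarrow> 'a hypergraph" where
  "complete_hypergraph l h V =
     (V, repeat_mset l (image_mset mset_set (mset_set {S. S \<subseteq> V \<and> card S = h})))"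

text \<open>For \<open>h = 1\<close> every edge is a singleton, so on two or more vertices no factor whatsoever is
  connected. Connectedness of factors can therefore only be claimed for \<open>h \<ge> 2\<close>.\<close>

lemma uniform_1_factor_not_connected:
  assumes fact: "is_factorization k r F (complete_hypergraph l 1 V)"
    and V: "card V > 1" and i: "i \<in> {1..k}"
  shows "\<not> hconnected (V, F i)"
proof
  assume con: "hconnected (V, F i)"
  have sub: "F i \<subseteq># snd (complete_hypergraph l 1 V)"
    using fact i unfolding is_factorization_def is_factor_def spanning_subhypergraph_def by auto
  have sing: "\<exists>x. e = {#x#}" if "e \<in># F i" for e
  proof -
    have "e \<in># snd (complete_hypergraph l 1 V)" using sub that by (rule mset_subset_eqD)
    then have "e \<in># image_mset mset_set (mset_set {S. S \<subseteq> V \<and> card S = 1})"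
      unfolding complete_hypergraph_def snd_conv
      by (simp only: count_greater_zero_iff[symmetric] count_repeat_mset nat_0_less_mult_iff)
    then have "\<exists>S. card S = 1 \<and> e = mset_set S"
      by (cases "finite {S. S \<subseteq> V \<and> card S = Suc 0}")
        auto
    then show ?thesis by (auto simp: card_1_singleton_iff)
  qed
  have "finite V" using V card.infinite by fastforce
  then have "\<not> (\<forall>u \<in> V. \<forall>v \<in> V. u = v)"
    using V card_le_Suc0_iff_eq[of V] by auto
  then obtain u v where uv: "u \<in> V" "v \<in> V" "u \<noteq> v" by blast
  have "\<exists>(t :: nat) w. w 0 = u \<and> w t = v \<and> (\<forall>j \<le> t. w j \<in> V) \<and>
     (\<forall>j < t. \<exists>e \<in># F i. w j \<in># e \<and> w (Suc j) \<in># e)"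
    by (rule con[unfolded hconnected_def fst_conv snd_conv, THEN bspec, THEN bspec, OF uv(1,2)])
  then obtain t :: nat and w where w: "w 0 = u" "w t = v"
    and step: "\<forall>j < t. \<exists>e \<in># F i. w j \<in># e \<and> w (Suc j) \<in># e"
    by (elim exE conjE) (rule that)
  have "w j = u" if "j \<le> t" for j
    using that
  proof (induction j)
    case 0
    then show ?case using w by simp
  next
    case (Suc j)
    from Suc.prems have "j < t" by simp
    then obtain e where e: "e \<in># F i" "w j \<in># e" "w (Suc j) \<in># e" using step by blast
    then obtain x where "e = {#x#}" using sing by blast
    then have "w (Suc j) = w j" using e by simp
    then show ?case using Suc by simp
  qed
  then show False using w uv by auto
qed

end

theory Submission
  imports Defs Complex_Main "HOL-Library.Disjoint_Sets"
begin

text \<open>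
  Start with all vertices amalgamated into one point \<open>\<alpha>\<close> of multiplicity \<open>n\<close>, every edge being an
  \<open>h\<close>-fold loop, and \<open>r i * n / h\<close> loops coloured \<open>i\<close>. Detach the vertices one at a time: if \<open>\<alpha>\<close>
  still stands for \<open>m\<close> vertices, the next vertex takes over one \<open>m\<close>-th of the incidences of \<open>\<alpha>\<close>,
  rounded to integers simultaneously in every colour class, in every class of edges with the same
  trace on the detached vertices, and, within each colour, in every component that remains after
  deleting \<open>\<alpha>\<close> and in the union of the components with at least two incidences. Such a rounding exists
  because a real circulation can be rounded to an integral one. Exactness on colours and traces
  yields the degrees and the multiplicities \<open>l\<close>. For \<open>r i \<ge> 2\<close>, the roundings on components keep the
  number of components hanging off \<open>\<alpha>\<close> at most \<open>(r i - 1) * m + 1\<close>, and hitting a component with at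
  least two incidences, which is never hit entirely, keeps the colour class connected. At \<open>m = 0\<close> the
  bound says that the colour class is connected.
\<close>

section \<open>Integral circulations\<close>

text \<open>Gaussian elimination: an equation with a nonzero coefficient determines one unknown from
  the others, so one equation and one unknown disappear together and the surplus of unknowns
  survives.\<close>

lemma homogeneous_system_nontrivial_solution:
  fixes M :: "'v \<Rightarrow> 'e \<Rightarrow> real"
  assumes "finite N" "finite A" "card N < card A"
  shows "\<exists>y. (\<forall>v\<in>N. (\<Sum>a\<in>A. M v a * y a) = 0) \<and> (\<exists>a\<in>A. y a \<noteq> 0)"
  using assms
proof (induction N arbitrary: A M rule: finite_induct)
  case empty
  then obtain a where "a \<in> A" by fastforce
  then show ?case by (intro exI[of _ "\<lambda>_. 1"]) auto
next
  case (insert v N)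
  show ?case
  proof (cases "\<forall>a\<in>A. M v a = 0")
    case True
    have "card N < card A" using insert by simp
    from insert.IH[OF insert.prems(1) this, of M] True show ?thesis by auto
  next
    case False
    then obtain b where b: "b \<in> A" "M v b \<noteq> 0" by blast
    have "card N < card (A - {b})" using insert b by simp
    \<comment> \<open>Equation \<open>v\<close> is solved for the unknown \<open>b\<close> and
      substituted into the equations in \<open>N\<close>; \<open>z\<close> below restores the
      coordinate \<open>b\<close>.\<close>
    from insert.IH[OF _ this, of "\<lambda>u a. M u a - M u b / M v b * M v a"] insert.prems
    obtain y a where y: "\<forall>u\<in>N. (\<Sum>a\<in>A - {b}. (M u a - M u b / M v b * M v a) * y a) = 0"
      and a: "a \<in> A - {b}" "y a \<noteq> 0" by auto
    define s where "s = (\<Sum>a\<in>A - {b}. M v a * y a)"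
    define z where "z = y(b := - s / M v b)"
    have split: "(\<Sum>a\<in>A. M u a * z a) = M u b * (- s / M v b) + (\<Sum>a\<in>A - {b}. M u a * y a)" for u
      using insert.prems(1) b by (subst sum.remove[of A b]) (auto simp: z_def intro!: sum.cong)
    have "(\<Sum>a\<in>A. M v a * z a) = 0" using b by (simp add: split s_def)
    moreover have "(\<Sum>a\<in>A. M u a * z a) = 0" if "u \<in> N" for u
    proof -
      have "0 = (\<Sum>a\<in>A - {b}. M u a * y a - M u b / M v b * (M v a * y a))"
        using y that by (simp add: algebra_simps)
      also have "\<dots> = (\<Sum>a\<in>A - {b}. M u a * y a) - M u b / M v b * s"
        by (simp only: sum_subtractf s_def sum_distrib_left)
      finally show ?thesis by (simp add: split)
    qed
    moreover have "z a \<noteq> 0" using a by (simp add: z_def)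
    ultimately show ?thesis using a by (intro exI[of _ z]) auto
  qed
qed

text \<open>All coordinates move together along \<open>y\<close>; \<open>t a\<close> is the moment
  at which coordinate \<open>a\<close> reaches the integer ahead of it. Stopping at the earliest
  such moment makes one coordinate integral before any other has overshot.\<close>

lemma push_until_integral:
  fixes f y :: "'e \<Rightarrow> real"
  assumes "finite A" "a \<in> A" "y a \<noteq> 0" and frac: "\<And>a. a \<in> A \<Longrightarrow> f a \<notin> \<int>"
  shows "\<exists>\<epsilon>. (\<forall>a\<in>A. \<lfloor>f a\<rfloor> \<le> f a + \<epsilon> * y a \<and> f a + \<epsilon> * y a \<le> \<lceil>f a\<rceil>) \<and>
             (\<exists>a\<in>A. f a + \<epsilon> * y a \<in> \<int>)"
proof -
  define t where "t a = ((if y a > 0 then \<lceil>f a\<rceil> else \<lfloor>f a\<rfloor>) - f a) / y a" for a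
  define B where "B = {a\<in>A. y a \<noteq> 0}"
  define \<epsilon> where "\<epsilon> = Min (t ` B)"
  have B: "finite B" "B \<noteq> {}" using assms by (auto simp: B_def)
  have strict: "\<lfloor>f a\<rfloor> < f a" "f a < \<lceil>f a\<rceil>" if "a \<in> A" for a
    using frac[OF that] by (metis Ints_of_int of_int_floor_le order_le_less,
      metis Ints_of_int le_of_int_ceiling order_le_less)
  have tpos: "t a > 0" if "a \<in> B" for a
    using that strict[of a] by (auto simp: t_def B_def divide_simps)
  have "\<epsilon> \<in> t ` B" unfolding \<epsilon>_def using B by (intro Min_in) auto
  then obtain b where b: "b \<in> B" "\<epsilon> = t b" by auto
  have le: "\<epsilon> \<le> t a" if "a \<in> B" for a unfolding \<epsilon>_def using B that by simp
  have pos: "\<epsilon> > 0" using b tpos by simp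
  have "f b + \<epsilon> * y b = (if y b > 0 then \<lceil>f b\<rceil> else \<lfloor>f b\<rfloor>)"
    using b by (simp add: t_def B_def)
  then have "f b + \<epsilon> * y b \<in> \<int>" by simp
  moreover have "\<lfloor>f a\<rfloor> \<le> f a + \<epsilon> * y a \<and> f a + \<epsilon> * y a \<le> \<lceil>f a\<rceil>" if a: "a \<in> A" for a
  proof -
    consider "y a = 0" | "y a > 0" | "y a < 0" by linarith
    then show ?thesis
    proof cases
      case 1 then show ?thesis by simp
    next
      case 2
      then have "\<epsilon> * y a \<le> \<lceil>f a\<rceil> - f a"
        using le[of a] a by (simp add: B_def t_def pos_le_divide_eq)
      moreover have "0 \<le> \<epsilon> * y a" using 2 pos by simp
      ultimately show ?thesis using strict[OF a] by linarith
    next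
      case 3
      then have "\<epsilon> * y a \<ge> \<lfloor>f a\<rfloor> - f a"
        using le[of a] a by (simp add: B_def t_def neg_le_divide_eq)
      moreover have "\<epsilon> * y a \<le> 0" using 3 pos by (simp add: mult_pos_neg less_imp_le)
      ultimately show ?thesis using strict[OF a] by linarith
    qed
  qed
  ultimately show ?thesis using b by (auto simp: B_def)
qed

definition circulation :: "'e set \<Rightarrow> ('e \<Rightarrow> 'v) \<Rightarrow> ('e \<Rightarrow> 'v) \<Rightarrow> ('e \<Rightarrow> real) \<Rightarrow> bool" where
  "circulation A tgt src f \<longleftrightarrow> (\<forall>v. (\<Sum>a\<in>{a\<in>A. tgt a = v}. f a) = (\<Sum>a\<in>{a\<in>A. src a = v}. f a))"

text \<open>Integral arcs contribute integers, so conservation makes the fractional inflow minus the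
  fractional outflow at \<open>v\<close> an integer. A single fractional arc would contradict this;
  a loop is counted on both sides.\<close>

lemma circulation_fractional_degree:
  assumes A: "finite A" and circ: "circulation A tgt src f" and F: "F = {a\<in>A. f a \<notin> \<int>}"
    and v: "v \<in> tgt ` F \<union> src ` F"
  shows "2 \<le> card {a\<in>F. tgt a = v} + card {a\<in>F. src a = v}"
proof (rule ccontr)
  have [simp]: "finite F" using A F by simp
  define H T where "H = {a\<in>F. tgt a = v}" and "T = {a\<in>F. src a = v}"
  have [simp]: "finite H" "finite T" by (auto simp: H_def T_def)
  have split: "(\<Sum>a\<in>{a\<in>A. e a = v}. f a) - (\<Sum>a\<in>{a\<in>F. e a = v}. f a) \<in> \<int>" for e
  proof -
    have "(\<Sum>a\<in>{a\<in>A. e a = v}. f a) - (\<Sum>a\<in>{a\<in>F. e a = v}. f a)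
        = (\<Sum>a\<in>{a\<in>A. e a = v} - {a\<in>F. e a = v}. f a)"
      using A F by (subst sum_diff) auto
    also have "\<dots> \<in> \<int>" using F by (intro Ints_sum) auto
    finally show ?thesis .
  qed
  have eq: "(\<Sum>a\<in>{a\<in>A. tgt a = v}. f a) = (\<Sum>a\<in>{a\<in>A. src a = v}. f a)"
    using circ by (simp add: circulation_def)
  have int: "sum f H - sum f T \<in> \<int>"
    using Ints_diff[OF split[of src] split[of tgt]] eq by (simp add: H_def T_def)
  assume "\<not> ?thesis"
  then have "card H + card T < 2" by (simp add: H_def T_def)
  moreover have "H \<noteq> {} \<or> T \<noteq> {}" using v by (auto simp: H_def T_def)
  ultimately have "(card H = 1 \<and> T = {}) \<or> (H = {} \<and> card T = 1)"
    by (metis One_nat_def \<open>finite H\<close> \<open>finite T\<close> add.commute add_0 add_lessD1 card_gt_0_iff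
        card_0_eq less_2_cases not_less_eq plus_1_eq_Suc less_numeral_extra(3))
  then obtain a where "a \<in> F" "(H = {a} \<and> T = {}) \<or> (H = {} \<and> T = {a})"
    by (auto simp: card_1_singleton_iff H_def T_def)
  then show False using int F by auto
qed

text \<open>The fractional arcs carry a nonzero circulation because they are at least as many as the
  vertices they touch, while the conservation equations of these vertices are linearly dependent.\<close>

lemma circulation_fractional_kernel:
  assumes A: "finite A" and circ: "circulation A tgt src f" and F: "F = {a\<in>A. f a \<notin> \<int>}"
    and ne: "F \<noteq> {}"
  shows "\<exists>y. circulation F tgt src y \<and> (\<exists>a\<in>F. y a \<noteq> 0)"
proof -
  have [simp]: "finite F" using A F by simp
  define N where "N = tgt ` F \<union> src ` F"
  have [simp]: "finite N" by (simp add: N_def)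
  have card_eq: "(\<Sum>v\<in>N. card {a\<in>F. e a = v}) = card F" if "e ` F \<subseteq> N" for e
    using sum.group[of F N e "\<lambda>_. 1::nat"] that by simp
  have "2 * card N = (\<Sum>v\<in>N. 2)" by simp
  also have "\<dots> \<le> (\<Sum>v\<in>N. card {a\<in>F. tgt a = v} + card {a\<in>F. src a = v})"
    using circulation_fractional_degree[OF A circ F] by (intro sum_mono) (auto simp: N_def)
  also have "\<dots> = 2 * card F"
    using card_eq[of tgt] card_eq[of src] by (simp add: sum.distrib N_def)
  finally have le: "card N \<le> card F" by simp
  obtain v0 where v0: "v0 \<in> N" using ne by (auto simp: N_def)
  \<comment> \<open>One vertex is left out so that the unknowns strictly outnumber the
    equations.\<close>
  have "card (N - {v0}) < card F" using le card_Diff1_less[of N v0] v0 by simp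
  define M :: "'b \<Rightarrow> 'a \<Rightarrow> real" where "M v a = of_bool (tgt a = v) - of_bool (src a = v)" for v a
  from homogeneous_system_nontrivial_solution[OF _ _ \<open>card (N - {v0}) < card F\<close>, of M]
  obtain y where y: "\<forall>v\<in>N - {v0}. (\<Sum>a\<in>F. M v a * y a) = 0" and nz: "\<exists>a\<in>F. y a \<noteq> 0" by auto
  \<comment> \<open>Every column of \<open>M\<close> sums to zero over \<open>N\<close>, so the
    equation left out at \<open>v0\<close> follows from the others.\<close>
  have "(\<Sum>v\<in>N. \<Sum>a\<in>F. M v a * y a) = (\<Sum>a\<in>F. (\<Sum>v\<in>N. M v a) * y a)"
    by (subst sum.swap) (simp add: sum_distrib_right)
  also have "\<dots> = 0"
  proof (intro sum.neutral ballI)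
    fix a assume "a \<in> F"
    then have "tgt a \<in> N" "src a \<in> N" by (auto simp: N_def)
    then have "(\<Sum>v\<in>N. M v a) = 0" by (simp add: M_def sum_subtractf)
    then show "(\<Sum>v\<in>N. M v a) * y a = 0" by simp
  qed
  finally have "(\<Sum>a\<in>F. M v0 a * y a) = 0"
    using v0 y by (simp add: sum.remove)
  with y have all: "(\<Sum>a\<in>F. M v a * y a) = 0" if "v \<in> N" for v using that by (cases "v = v0") auto
  have "(\<Sum>a\<in>{a\<in>F. tgt a = v}. y a) = (\<Sum>a\<in>{a\<in>F. src a = v}. y a)" for v
  proof (cases "v \<in> N")
    case True
    have "(\<Sum>a\<in>F. M v a * y a) = (\<Sum>a\<in>F. if tgt a = v then y a else 0) - (\<Sum>a\<in>F. if src a = v then y a else 0)"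
      unfolding sum_subtractf[symmetric] by (intro sum.cong) (auto simp: M_def)
    then show ?thesis using all[OF True] by (simp add: sum.inter_filter)
  next
    case False
    then have "{a\<in>F. tgt a = v} = {}" "{a\<in>F. src a = v} = {}" by (auto simp: N_def)
    then show ?thesis by (simp only:)
  qed
  then show ?thesis using nz by (auto simp: circulation_def)
qed

text \<open>Induction on the number of fractional arcs. Pushing along a circulation supported on
  them preserves conservation, leaves integral arcs alone and makes at least one more arc
  integral.\<close>

theorem circulation_rounding:
  fixes tgt src :: "'e \<Rightarrow> 'v"
  assumes A: "finite A" and circ: "circulation A tgt src f"
  shows "\<exists>g :: 'e \<Rightarrow> int. circulation A tgt src (\<lambda>a. of_int (g a)) \<and>
           (\<forall>a\<in>A. \<lfloor>f a\<rfloor> \<le> g a \<and> g a \<le> \<lceil>f a\<rceil>)"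
  using circ
proof (induction "card {a\<in>A. f a \<notin> \<int>}" arbitrary: f rule: less_induct)
  case less
  define F where "F = {a\<in>A. f a \<notin> \<int>}"
  have [simp]: "finite F" using A by (simp add: F_def)
  show ?case
  proof (cases "F = {}")
    case True
    then have int: "of_int \<lfloor>f a\<rfloor> = f a" if "a \<in> A" for a
      using that by (auto simp: F_def elim: Ints_cases)
    have "(\<Sum>a\<in>{a\<in>A. e a = v}. of_int \<lfloor>f a\<rfloor>) = (\<Sum>a\<in>{a\<in>A. e a = v}. f a)"
      for e :: "'e \<Rightarrow> 'v" and v by (intro sum.cong) (auto simp: int)
    then have "circulation A tgt src (\<lambda>a. of_int \<lfloor>f a\<rfloor>)"
      using less.prems by (simp add: circulation_def)
    then show ?thesis by (intro exI[of _ "\<lambda>a. \<lfloor>f a\<rfloor>"]) (auto simp: floor_le_ceiling)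
  next
    case False
    from circulation_fractional_kernel[OF A less.prems F_def False]
    obtain y b where y: "circulation F tgt src y" and b: "b \<in> F" "y b \<noteq> 0" by blast
    from push_until_integral[of F b y f, OF \<open>finite F\<close> b]
    obtain \<epsilon> c where \<epsilon>: "\<forall>a\<in>F. \<lfloor>f a\<rfloor> \<le> f a + \<epsilon> * y a \<and> f a + \<epsilon> * y a \<le> \<lceil>f a\<rceil>"
      and c: "c \<in> F" "f c + \<epsilon> * y c \<in> \<int>" by (auto simp: F_def)
    define f' where "f' a = f a + (if a \<in> F then \<epsilon> * y a else 0)" for a
    have bd: "\<lfloor>f a\<rfloor> \<le> f' a \<and> f' a \<le> \<lceil>f a\<rceil>" if "a \<in> A" for a
      using \<epsilon> by (auto simp: f'_def)
    have sum_f': "(\<Sum>a\<in>{a\<in>A. e a = v}. f' a) = (\<Sum>a\<in>{a\<in>A. e a = v}. f a) + \<epsilon> * (\<Sum>a\<in>{a\<in>F. e a = v}. y a)"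
      for e :: "'e \<Rightarrow> 'v" and v
    proof -
      have "(\<Sum>a\<in>{a\<in>A. e a = v}. if a \<in> F then \<epsilon> * y a else 0) = (\<Sum>a\<in>{a\<in>F. e a = v}. \<epsilon> * y a)"
        using A by (intro sum.mono_neutral_cong_right) (auto simp: F_def)
      then show ?thesis by (simp add: f'_def sum.distrib sum_distrib_left)
    qed
    have circ': "circulation A tgt src f'"
      using less.prems y by (simp add: circulation_def sum_f')
    have "{a\<in>A. f' a \<notin> \<int>} \<subseteq> F - {c}" using c by (auto simp: f'_def F_def)
    then have "{a\<in>A. f' a \<notin> \<int>} \<subset> F" using c by blast
    then have "card {a\<in>A. f' a \<notin> \<int>} < card {a\<in>A. f a \<notin> \<int>}"
      using psubset_card_mono[OF \<open>finite F\<close>] by (simp add: F_def)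
    from less.hyps[OF this circ'] obtain g :: "_ \<Rightarrow> int" where
      g: "circulation A tgt src (\<lambda>a. of_int (g a))" "\<forall>a\<in>A. \<lfloor>f' a\<rfloor> \<le> g a \<and> g a \<le> \<lceil>f' a\<rceil>" by blast
    \<comment> \<open>\<open>f'\<close> lies between the floor and the ceiling of \<open>f\<close>,
      so rounding \<open>f'\<close> stays within the same integers.\<close>
    have "\<lfloor>f a\<rfloor> \<le> g a \<and> g a \<le> \<lceil>f a\<rceil>" if "a \<in> A" for a
      using bd[OF that] g(2) that by (meson ceiling_le_iff le_floor_iff order_trans)
    then show ?thesis using g by blast
  qed
qed

section \<open>Simultaneous rounding along nested partitions\<close>

datatype ('e, 'w, 'g, 'c, 't) arc = Elem 'e | Wing 'w | Grp 'g | Col 'c | Typ 't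

text \<open>Rounding all sums along a chain of coarser and coarser partitions and, simultaneously, along
  one further partition is rounding a circulation: each class is an arc from its parent class, each
  element an arc from the finest class of the chain containing it to its class in the other
  partition.\<close>

lemma hierarchical_rounding:
  fixes \<phi> :: "'e \<Rightarrow> real" and p :: "'e \<Rightarrow> 'w" and g :: "'w \<Rightarrow> 'g" and c :: "'g \<Rightarrow> 'c" and q :: "'e \<Rightarrow> 't"
  assumes E: "finite E"
  defines "rounds x Y \<equiv> \<lfloor>sum \<phi> Y\<rfloor> \<le> sum x Y \<and> sum x Y \<le> \<lceil>sum \<phi> Y\<rceil>"
  shows "\<exists>x :: 'e \<Rightarrow> int. (\<forall>e\<in>E. rounds x {e}) \<and> (\<forall>w. rounds x {e\<in>E. p e = w}) \<and>
    (\<forall>k. rounds x {e\<in>E. g (p e) = k}) \<and> (\<forall>i. rounds x {e\<in>E. c (g (p e)) = i}) \<and>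
    (\<forall>t. rounds x {e\<in>E. q e = t})"
proof -
  let ?W = "p ` E" and ?G = "g ` p ` E" and ?C = "c ` g ` p ` E" and ?T = "q ` E"
  define A :: "('e, 'w, 'g, 'c, 't) arc set"
    where "A = Elem ` E \<union> Wing ` ?W \<union> Grp ` ?G \<union> Col ` ?C \<union> Typ ` ?T"
  \<comment> \<open>Vertices reuse the constructors: \<open>Some\<close> of a class arc stands for
    the class, \<open>None\<close> is a root. Flow runs from the root through colours, groups and
    wings, along the elements into the types, and back to the root.\<close>
  define tgt :: "('e, 'w, 'g, 'c, 't) arc \<Rightarrow> ('e, 'w, 'g, 'c, 't) arc option" where
    "tgt a = (case a of Elem e \<Rightarrow> Some (Typ (q e)) | Wing w \<Rightarrow> Some a | Grp k \<Rightarrow> Some a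
                | Col i \<Rightarrow> Some a | Typ t \<Rightarrow> None)" for a
  define src :: "('e, 'w, 'g, 'c, 't) arc \<Rightarrow> ('e, 'w, 'g, 'c, 't) arc option" where
    "src a = (case a of Elem e \<Rightarrow> Some (Wing (p e)) | Wing w \<Rightarrow> Some (Grp (g w))
                | Grp k \<Rightarrow> Some (Col (c k)) | Col i \<Rightarrow> None | Typ t \<Rightarrow> Some a)" for a
  define f where "f a = (case a of Elem e \<Rightarrow> \<phi> e | Wing w \<Rightarrow> sum \<phi> {e\<in>E. p e = w}
      | Grp k \<Rightarrow> sum \<phi> {e\<in>E. g (p e) = k} | Col i \<Rightarrow> sum \<phi> {e\<in>E. c (g (p e)) = i}
      | Typ t \<Rightarrow> sum \<phi> {e\<in>E. q e = t})" for a
  have fin: "finite A" using E by (simp add: A_def)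
  have into: "{a\<in>A. tgt a = Some (Wing w)} = (if w \<in> ?W then {Wing w} else {})"
    "{a\<in>A. tgt a = Some (Grp k)} = (if k \<in> ?G then {Grp k} else {})"
    "{a\<in>A. tgt a = Some (Col i)} = (if i \<in> ?C then {Col i} else {})"
    "{a\<in>A. tgt a = Some (Typ t)} = Elem ` {e\<in>E. q e = t}"
    "{a\<in>A. tgt a = Some (Elem e)} = {}"
    "{a\<in>A. tgt a = None} = Typ ` ?T" for w k i t e
    by (auto simp: A_def tgt_def)
  have out: "{a\<in>A. src a = Some (Wing w)} = Elem ` {e\<in>E. p e = w}"
    "{a\<in>A. src a = Some (Grp k)} = Wing ` {w\<in>?W. g w = k}"
    "{a\<in>A. src a = Some (Col i)} = Grp ` {k\<in>?G. c k = i}"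
    "{a\<in>A. src a = Some (Typ t)} = (if t \<in> ?T then {Typ t} else {})"
    "{a\<in>A. src a = Some (Elem e)} = {}"
    "{a\<in>A. src a = None} = Col ` ?C" for w k i t e
    by (auto simp: A_def src_def)
  have group: "(\<Sum>y\<in>{y\<in>Y. s y = z}. sum \<phi> {e\<in>E. r e = y}) = sum \<phi> {e\<in>E. s (r e) = z}"
    if "r ` E = Y" for r :: "'e \<Rightarrow> 'y" and s :: "'y \<Rightarrow> 'z" and Y z
  proof -
    have "sum \<phi> {e\<in>E. s (r e) = z} = (\<Sum>y\<in>{y\<in>Y. s y = z}. sum \<phi> {e\<in>{e\<in>E. s (r e) = z}. r e = y})"
      using E that by (intro sum.group[symmetric]) auto
    also have "\<dots> = (\<Sum>y\<in>{y\<in>Y. s y = z}. sum \<phi> {e\<in>E. r e = y})"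
      by (intro sum.cong refl arg_cong[of _ _ "sum \<phi>"]) auto
    finally show ?thesis by simp
  qed
  have empty: "{e\<in>E. p e = w} = {}" if "w \<notin> ?W" for w using that by auto
  have total: "(\<Sum>y\<in>r ` E. sum \<phi> {e\<in>E. r e = y}) = sum \<phi> E" for r :: "'e \<Rightarrow> 'y"
    using E by (intro sum.group) auto
  have "circulation A tgt src f"
    unfolding circulation_def
  proof
    fix v show "(\<Sum>a\<in>{a\<in>A. tgt a = v}. f a) = (\<Sum>a\<in>{a\<in>A. src a = v}. f a)"
    proof (cases v)
      case None
      have "(\<lambda>e. c (g (p e))) ` E = ?C" by auto
      then show ?thesis unfolding None into out
        using total[of q] total[of "\<lambda>e. c (g (p e))"] by (simp add: sum.reindex inj_on_def f_def)
    next
      case (Some a)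
      show ?thesis
      proof (cases a)
        case (Elem e) then show ?thesis by (simp add: Some into out)
      next
        case (Wing w) then show ?thesis
          unfolding Some Wing into out
          by (cases "w \<in> ?W") (simp_all add: sum.reindex inj_on_def f_def empty)
      next
        case (Grp k) then show ?thesis
          unfolding Some Grp into out
          by (cases "k \<in> ?G") (auto simp: sum.reindex inj_on_def f_def group intro!: sum.neutral)
      next
        case (Col i) then show ?thesis
          unfolding Some Col into out
          using group[of "\<lambda>e. g (p e)" ?G c i]
          by (cases "i \<in> ?C") (auto simp: sum.reindex inj_on_def f_def image_image intro!: sum.neutral)
      next
        case (Typ t) 
        then show ?thesis unfolding Some Typ into out
          by (cases "t \<in> ?T") (auto simp: sum.reindex inj_on_def f_def intro!: sum.neutral)
      qed
    qed
  qed
  from circulation_rounding[OF fin this] obtain y :: "_ \<Rightarrow> int" where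
    circ: "circulation A tgt src (\<lambda>a. of_int (y a))" and bd: "\<And>a. a \<in> A \<Longrightarrow> \<lfloor>f a\<rfloor> \<le> y a \<and> y a \<le> \<lceil>f a\<rceil>"
    by blast
  have cons: "(\<Sum>a\<in>{a\<in>A. tgt a = v}. y a) = (\<Sum>a\<in>{a\<in>A. src a = v}. y a)" for v
  proof -
    have "real_of_int (\<Sum>a\<in>{a\<in>A. tgt a = v}. y a) = real_of_int (\<Sum>a\<in>{a\<in>A. src a = v}. y a)"
      using circ unfolding circulation_def of_int_sum by blast
    then show ?thesis by (simp only: of_int_eq_iff)
  qed
  define x where "x e = y (Elem e)" for e
  \<comment> \<open>Conservation forces the value on each class arc to be the sum of
    \<open>x\<close> over that class, so bounds on arcs become bounds on class sums.\<close>
  have W: "y (Wing w) = sum x {e\<in>E. p e = w}" if "w \<in> ?W" for w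
    using cons[of "Some (Wing w)"] that unfolding into out by (simp add: sum.reindex inj_on_def x_def)
  have G: "y (Grp k) = sum x {e\<in>E. g (p e) = k}" if "k \<in> ?G" for k
  proof -
    have "y (Grp k) = (\<Sum>w\<in>{w\<in>?W. g w = k}. y (Wing w))"
      using cons[of "Some (Grp k)"] that unfolding into out by (auto simp: sum.reindex inj_on_def)
    also have "\<dots> = (\<Sum>w\<in>{w\<in>?W. g w = k}. sum x {e\<in>{e\<in>E. g (p e) = k}. p e = w})"
      by (intro sum.cong refl) (auto simp: W intro!: arg_cong[of _ _ "sum x"])
    also have "\<dots> = sum x {e\<in>E. g (p e) = k}" using E by (intro sum.group) auto
    finally show ?thesis .
  qed
  have C: "y (Col i) = sum x {e\<in>E. c (g (p e)) = i}" if "i \<in> ?C" for i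
  proof -
    have "y (Col i) = (\<Sum>k\<in>{k\<in>?G. c k = i}. y (Grp k))"
      using cons[of "Some (Col i)"] that unfolding into out by (auto simp: sum.reindex inj_on_def)
    also have "\<dots> = (\<Sum>k\<in>{k\<in>?G. c k = i}. sum x {e\<in>{e\<in>E. c (g (p e)) = i}. g (p e) = k})"
      by (intro sum.cong refl) (auto simp: G intro!: arg_cong[of _ _ "sum x"])
    also have "\<dots> = sum x {e\<in>E. c (g (p e)) = i}" using E by (intro sum.group) auto
    finally show ?thesis .
  qed
  have T: "y (Typ t) = sum x {e\<in>E. q e = t}" if "t \<in> ?T" for t
    using cons[of "Some (Typ t)"] that unfolding into out by (simp add: sum.reindex inj_on_def x_def)
  have zero: "rounds x {e\<in>E. r e = z}" if "z \<notin> r ` E" for r :: "'e \<Rightarrow> 'z" and z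
  proof -
    have "{e\<in>E. r e = z} = {}" using that by auto
    then show ?thesis unfolding rounds_def by (simp only: sum.empty) simp
  qed
  have "rounds x {e}" if "e \<in> E" for e
    using bd[of "Elem e"] that by (simp add: rounds_def x_def f_def A_def)
  moreover have "rounds x {e\<in>E. p e = w}" for w
    using bd[of "Wing w"] W[of w] zero[of w p] by (cases "w \<in> ?W") (simp_all add: rounds_def f_def A_def)
  moreover have "rounds x {e\<in>E. g (p e) = k}" for k
  proof (cases "k \<in> ?G")
    case True
    then have "Grp k \<in> A" by (simp add: A_def)
    then show ?thesis using bd[of "Grp k"] G[OF True] by (simp add: rounds_def f_def)
  next
    case False
    then show ?thesis by (intro zero) auto
  qed
  moreover have "rounds x {e\<in>E. c (g (p e)) = i}" for i
  proof (cases "i \<in> ?C")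
    case True
    then have "Col i \<in> A" by (simp add: A_def)
    then show ?thesis using bd[of "Col i"] C[OF True] by (simp add: rounds_def f_def)
  next
    case False
    then show ?thesis by (intro zero) auto
  qed
  moreover have "rounds x {e\<in>E. q e = t}" for t
    using bd[of "Typ t"] T[of t] zero[of t q] by (cases "t \<in> ?T") (simp_all add: rounds_def f_def A_def)
  ultimately show ?thesis by blast
qed

section \<open>Detaching a vertex in one colour class\<close>

text \<open>Detaching proceeds vertex by vertex. When the vertices in \<open>W\<close> have been detached,
  the other \<open>n - card W\<close> are still one point \<open>\<alpha>\<close>, and an edge is recorded by its trace
  \<open>S \<subseteq> W\<close>, the remaining \<open>h - card S\<close> incidences (hinges) being with \<open>\<alpha>\<close>; \<open>f S\<close> is the
  number of edges with trace \<open>S\<close> in the colour class. The blocks of \<open>P\<close> are the components of the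
  colour class after deletion of \<open>\<alpha>\<close>. Edges with empty trace belong to no block; they get
  the junk wing \<open>{}\<close>.\<close>

definition wing :: "'a set set \<Rightarrow> 'a set \<Rightarrow> 'a set" where
  "wing P S = \<Union>{B\<in>P. B \<inter> S \<noteq> {}}"

definition hinges :: "nat \<Rightarrow> 'a set \<Rightarrow> ('a set \<Rightarrow> nat) \<Rightarrow> 'a set set \<Rightarrow> 'a set \<Rightarrow> nat" where
  "hinges h W f P B = (\<Sum>S\<in>{S\<in>Pow W. wing P S = B}. f S * (h - card S))"

definition link :: "'a set \<Rightarrow> ('a set \<Rightarrow> nat) \<Rightarrow> 'a rel" where
  "link W f = {(u, v). \<exists>S\<in>Pow W. 0 < f S \<and> u \<in> S \<and> v \<in> S}"

text \<open>The last inequality is the bound on the number of pieces hanging off \<open>\<alpha>\<close> that is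
  necessary for a connected detachment: \<open>r * m\<close> hinges have to join the pieces and the \<open>m\<close>
  vertices still to be detached into one component.\<close>

definition colour_inv ::
  "nat \<Rightarrow> nat \<Rightarrow> nat \<Rightarrow> 'a set \<Rightarrow> ('a set \<Rightarrow> nat) \<Rightarrow> 'a set set \<Rightarrow> bool" where
  "colour_inv n h r W f P \<longleftrightarrow>
     (\<forall>u\<in>W. (\<Sum>S\<in>Pow W. of_bool (u \<in> S) * f S) = r) \<and>
     h * (\<Sum>S\<in>Pow W. f S) = r * n \<and>
     partition_on W P \<and>
     (\<forall>S\<in>Pow W. S \<noteq> {} \<and> 0 < f S \<longrightarrow> (\<exists>B\<in>P. S \<subseteq> B)) \<and>
     (2 \<le> h \<and> 2 \<le> r \<longrightarrow>
        (\<forall>B\<in>P. \<forall>u\<in>B. \<forall>v\<in>B. (u, v) \<in> (link W f)\<^sup>*) \<and>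
        (card W < n \<longrightarrow> (\<forall>B\<in>P. \<exists>S. S \<subseteq> B \<and> S \<noteq> {} \<and> card S < h \<and> 0 < f S)) \<and>
        card P + f {} \<le> (r - 1) * (n - card W) + 1)"

text \<open>\<open>x S\<close> of the edges with trace \<open>S\<close> acquire the new vertex \<open>v\<close>.\<close>

definition split_vertex :: "'a \<Rightarrow> ('a set \<Rightarrow> nat) \<Rightarrow> ('a set \<Rightarrow> nat) \<Rightarrow> 'a set \<Rightarrow> nat" where
  "split_vertex v f x S = (if v \<in> S then x (S - {v}) else f S - x S)"

section \<open>Wings and hinge counts\<close>

lemma wing_empty [simp]: "wing P {} = {}"
  by (simp add: wing_def)

lemma wing_eq:
  assumes "partition_on W P" "B \<in> P" "S \<subseteq> B" "S \<noteq> {}"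
  shows "wing P S = B"
proof -
  have "C = B" if "C \<in> P" "C \<inter> S \<noteq> {}" for C
    using partition_onD2[OF assms(1)] that assms by (auto simp: disjoint_def)
  moreover have "B \<inter> S \<noteq> {}" using assms by auto
  ultimately have "{B\<in>P. B \<inter> S \<noteq> {}} = {B}" using assms(2) by blast
  then show ?thesis by (simp add: wing_def)
qed

lemma sym_link: "sym (link W f)"
  by (auto simp: link_def sym_def)

lemma sum_Pow_insert:
  fixes a :: "'a set \<Rightarrow> 'b::comm_monoid_add"
  assumes "finite W" "v \<notin> W"
  shows "(\<Sum>S\<in>Pow (insert v W). a S) = (\<Sum>S\<in>Pow W. a S + a (insert v S))"
proof -
  have "(\<Sum>S\<in>Pow (insert v W). a S) = (\<Sum>S\<in>Pow W. a S) + (\<Sum>S\<in>insert v ` Pow W. a S)"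
    unfolding Pow_insert using assms by (intro sum.union_disjoint) auto
  also have "(\<Sum>S\<in>insert v ` Pow W. a S) = (\<Sum>S\<in>Pow W. a (insert v S))"
  proof (rule sum.reindex_cong)
    show "inj_on (insert v) (Pow W)"
      using assms by (intro inj_onI) (metis PowD insert_ident subsetD)
  qed simp_all
  finally show ?thesis by (simp add: sum.distrib)
qed

text \<open>A nonempty trace that carries edges lies in exactly one block, which is its wing. Other
  nonempty traces may meet several blocks, but there \<open>a\<close> vanishes.\<close>

lemma sum_by_wings:
  fixes a f :: "'a set \<Rightarrow> nat"
  assumes W: "finite W" and P: "partition_on W P"
    and supp: "\<forall>S\<in>Pow W. S \<noteq> {} \<and> 0 < f S \<longrightarrow> (\<exists>B\<in>P. S \<subseteq> B)"
    and a: "\<And>S. f S = 0 \<Longrightarrow> a S = 0"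
  shows "(\<Sum>S\<in>Pow W. a S) = a {} + (\<Sum>B\<in>P. \<Sum>S\<in>{S\<in>Pow W. wing P S = B}. a S)"
proof -
  let ?D = "{S\<in>Pow W. S \<noteq> {} \<and> 0 < f S}"
  have finP: "finite P" using finite_elements[OF W P] .
  have ne: "{} \<notin> P" using P by (simp add: partition_on_def)
  have a': "0 < f S" if "0 < a S" for S using a[of S] that by (cases "f S = 0") auto
  have "wing P S \<in> P" if "S \<in> ?D" for S
  proof -
    from supp that obtain B where "B \<in> P" "S \<subseteq> B" by blast
    then show ?thesis using wing_eq[OF P] that by simp
  qed
  then have "(\<Sum>B\<in>P. \<Sum>S\<in>{S\<in>?D. wing P S = B}. a S) = (\<Sum>S\<in>?D. a S)"
    using finP W by (intro sum.group) auto
  moreover have "(\<Sum>S\<in>{S\<in>?D. wing P S = B}. a S) = (\<Sum>S\<in>{S\<in>Pow W. wing P S = B}. a S)"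
    if "B \<in> P" for B
    using that ne W by (intro sum.mono_neutral_left) (auto dest: a')
  moreover have "(\<Sum>S\<in>Pow W. a S) = a {} + (\<Sum>S\<in>Pow W - {{}}. a S)"
    using W by (intro sum.remove) auto
  moreover have "(\<Sum>S\<in>Pow W - {{}}. a S) = (\<Sum>S\<in>?D. a S)"
    using W by (intro sum.mono_neutral_right) (auto dest: a')
  ultimately show ?thesis by simp
qed

text \<open>Double counting: of the \<open>r * n\<close> incidences of the colour class,
  \<open>r * card W\<close> fall on detached vertices, and the others are hinges.\<close>

lemma total_hinges:
  assumes W: "finite W" and inv: "colour_inv n h r W f P" and "card W \<le> n"
    and le: "\<And>S. S \<subseteq> W \<Longrightarrow> 0 < f S \<Longrightarrow> card S \<le> h"
  shows "(\<Sum>S\<in>Pow W. f S * (h - card S)) = r * (n - card W)"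
proof -
  have "(\<Sum>S\<in>Pow W. f S * card S) = (\<Sum>S\<in>Pow W. \<Sum>u\<in>W. of_bool (u \<in> S) * f S)"
  proof (intro sum.cong refl)
    fix S assume "S \<in> Pow W"
    then have "W \<inter> S = S" by auto
    have "(\<Sum>u\<in>W. of_bool (u \<in> S) * f S) = (\<Sum>u\<in>W. of_bool (u \<in> S)) * f S"
      by (simp only: sum_distrib_right)
    also have "\<dots> = card S * f S" using W \<open>W \<inter> S = S\<close> by (simp add: sum_of_bool_eq)
    finally show "f S * card S = (\<Sum>u\<in>W. of_bool (u \<in> S) * f S)" by simp
  qed
  also have "\<dots> = (\<Sum>u\<in>W. r)"
    using inv by (subst sum.swap) (simp add: colour_inv_def)
  finally have deg: "(\<Sum>S\<in>Pow W. f S * card S) = r * card W" by simp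
  have "(\<Sum>S\<in>Pow W. f S * (h - card S)) + (\<Sum>S\<in>Pow W. f S * card S) = (\<Sum>S\<in>Pow W. h * f S)"
    unfolding sum.distrib[symmetric]
  proof (intro sum.cong refl)
    fix S assume "S \<in> Pow W"
    then show "f S * (h - card S) + f S * card S = h * f S"
      using le[of S] by (cases "f S = 0") (auto simp: add_mult_distrib2[symmetric])
  qed
  also have "\<dots> = r * n" using inv by (simp add: colour_inv_def sum_distrib_left)
  finally show ?thesis using deg by (simp add: diff_mult_distrib2)
qed

text \<open>With \<open>m = n - card W\<close>, \<open>wing_bound\<close> says in integers that the
  hits in a block are at most its hinges divided by \<open>m\<close>, rounded up.
  \<open>big_hit\<close> is the part of rounding down that is used for the junk wing together with
  the blocks having at least two hinges.\<close>

locale colour_step =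
  fixes n h r :: nat and W :: "'a set" and f x :: "'a set \<Rightarrow> nat" and P :: "'a set set" and v :: 'a
  assumes finW: "finite W" and inv: "colour_inv n h r W f P" and v: "v \<notin> W" and less: "card W < n"
    and card_le: "\<And>S. S \<subseteq> W \<Longrightarrow> 0 < f S \<Longrightarrow> card S \<le> h"
    and x_le: "\<And>S. S \<subseteq> W \<Longrightarrow> x S \<le> f S"
    and x_0: "\<And>S. \<not> S \<subseteq> W \<Longrightarrow> x S = 0"
    and f_0: "\<And>S. \<not> S \<subseteq> W \<Longrightarrow> f S = 0"
    and total: "(\<Sum>S\<in>Pow W. x S) = r"
    and wing_bound: "\<And>B. B \<in> P \<Longrightarrow>
      (n - card W) * (\<Sum>S\<in>{S\<in>Pow W. wing P S = B}. x S) < hinges h W f P B + (n - card W)"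
    and big_hit: "n - card W \<le>
        (\<Sum>S\<in>{S\<in>Pow W. wing P S = {} \<or> 2 \<le> hinges h W f P (wing P S)}. f S * (h - card S)) \<Longrightarrow>
      0 < (\<Sum>S\<in>{S\<in>Pow W. wing P S = {} \<or> 2 \<le> hinges h W f P (wing P S)}. x S)"
begin

abbreviation "m \<equiv> n - card W"
abbreviation "c \<equiv> hinges h W f P"
abbreviation "f' \<equiv> split_vertex v f x"

definition hits :: "'a set \<Rightarrow> nat" where
  "hits B = (\<Sum>S\<in>{S\<in>Pow W. wing P S = B}. x S)"

text \<open>An edge that acquires \<open>v\<close> ties \<open>v\<close> to the block of its old
  trace, so all blocks that are hit collapse into one component.\<close>

definition merged :: "'a set" where
  "merged = insert v (\<Union>{B\<in>P. 0 < hits B})"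

definition P' :: "'a set set" where
  "P' = insert merged {B\<in>P. hits B = 0}"

lemma part: "partition_on W P"
  and supp: "\<forall>S\<in>Pow W. S \<noteq> {} \<and> 0 < f S \<longrightarrow> (\<exists>B\<in>P. S \<subseteq> B)"
  using inv by (auto simp: colour_inv_def)

lemma finP: "finite P"
  using finite_elements[OF finW part] .

lemma block_sub: "B \<in> P \<Longrightarrow> B \<subseteq> W" and block_ne: "B \<in> P \<Longrightarrow> B \<noteq> {}"
  using part by (auto simp: partition_on_def)

lemma v_notin_block: "B \<in> P \<Longrightarrow> v \<notin> B"
  using block_sub v by blast

lemma x_le': "x S \<le> f S"
  using x_le x_0 f_0 by (cases "S \<subseteq> W") auto

lemma wing_block:
  assumes "0 < f S" "S \<noteq> {}"
  shows "wing P S \<in> P" "S \<subseteq> wing P S"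
proof -
  have "S \<in> Pow W" using assms f_0 by (metis PowI less_numeral_extra(3))
  then obtain B where "B \<in> P" "S \<subseteq> B" using supp assms by blast
  with wing_eq[OF part this] assms show "wing P S \<in> P" "S \<subseteq> wing P S" by auto
qed

lemma hits_pos_iff: "0 < hits B \<longleftrightarrow> (\<exists>S\<in>Pow W. wing P S = B \<and> 0 < x S)"
  unfolding hits_def using finW by (subst neq0_conv[symmetric], subst sum_eq_0_iff) auto

lemma f'_old: "S \<subseteq> W \<Longrightarrow> f' S = f S - x S" and f'_new: "S \<subseteq> W \<Longrightarrow> f' (insert v S) = x S"
  using v by (auto simp: split_vertex_def intro!: arg_cong[of _ _ x])

lemma f'_sum: "S \<subseteq> W \<Longrightarrow> f' S + f' (insert v S) = f S"
  by (simp add: f'_old f'_new x_le)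

section \<open>Degrees, edge counts and blocks after the step\<close>

lemma degrees':
  assumes "u \<in> insert v W"
  shows "(\<Sum>S\<in>Pow (insert v W). of_bool (u \<in> S) * f' S) = r"
proof (cases "u = v")
  case True
  have "(\<Sum>S\<in>Pow (insert v W). of_bool (u \<in> S) * f' S) = (\<Sum>S\<in>Pow W. x S)"
    unfolding sum_Pow_insert[OF finW v] using True v by (intro sum.cong) (auto simp: f'_new)
  then show ?thesis using total by simp
next
  case False
  then have "(\<Sum>S\<in>Pow (insert v W). of_bool (u \<in> S) * f' S) = (\<Sum>S\<in>Pow W. of_bool (u \<in> S) * f S)"
    unfolding sum_Pow_insert[OF finW v]
    by (intro sum.cong) (auto simp: f'_sum simp flip: add_mult_distrib2)
  then show ?thesis using False assms inv by (simp add: colour_inv_def)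
qed

lemma size': "h * (\<Sum>S\<in>Pow (insert v W). f' S) = r * n"
  using inv unfolding sum_Pow_insert[OF finW v] by (simp add: f'_sum colour_inv_def)

lemma part': "partition_on (insert v W) P'"
proof -
  have W: "\<Union>P = W" and dis: "disjoint P" using part by (auto simp: partition_on_def)
  have "\<Union>P' = insert v (\<Union>P)"
    unfolding P'_def merged_def by auto
  moreover have "disjoint P'"
    unfolding disjoint_def
  proof (intro ballI impI)
    fix A B assume AB: "A \<in> P'" "B \<in> P'" "A \<noteq> B"
    have *: "C \<inter> merged = {}" if "C \<in> P" "hits C = 0" for C
    proof -
      have "C \<inter> D = {}" if "D \<in> P" "0 < hits D" for D
        using dis \<open>C \<in> P\<close> \<open>hits C = 0\<close> that by (metis disjointD less_irrefl)
      then show ?thesis using v_notin_block[OF \<open>C \<in> P\<close>] by (auto simp: merged_def)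
    qed
    show "A \<inter> B = {}"
      using AB *[of A] *[of B] disjointD[OF dis, of A B] unfolding P'_def by blast
  qed
  moreover have "{} \<notin> P'" using block_ne by (auto simp: P'_def merged_def)
  ultimately show ?thesis using W by (simp add: partition_on_def)
qed

lemma block_in_P': "B \<in> P \<Longrightarrow> \<exists>C\<in>P'. B \<subseteq> C"
  by (cases "hits B = 0") (auto simp: P'_def merged_def)

lemma hit_sub_merged:
  assumes "S \<subseteq> W" "0 < x S"
  shows "insert v S \<subseteq> merged"
proof (cases "S = {}")
  case False
  have "0 < f S" using assms x_le[of S] by simp
  from wing_block[OF this False] assms show ?thesis
    by (auto simp: merged_def hits_pos_iff)
qed (simp add: merged_def)

lemma supp':
  assumes S: "S \<in> Pow (insert v W)" "S \<noteq> {}" "0 < f' S"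
  shows "\<exists>B\<in>P'. S \<subseteq> B"
proof (cases "v \<in> S")
  case True
  then have "0 < x (S - {v})" "S - {v} \<subseteq> W" "insert v (S - {v}) = S"
    using S by (auto simp: split_vertex_def)
  then show ?thesis using hit_sub_merged[of "S - {v}"] by (auto simp: P'_def)
next
  case False
  then have "S \<subseteq> W" "0 < f S" using S by (auto simp: split_vertex_def)
  then show ?thesis using supp S block_in_P' by (meson PowI order_trans)
qed

text \<open>No edge loses a vertex of its trace: an edge with trace \<open>S\<close> ends up with
  trace \<open>S\<close> or \<open>insert v S\<close>.\<close>

lemma link_mono: "link W f \<subseteq> link (insert v W) f'"
proof
  fix p assume "p \<in> link W f"
  then obtain u w S where p: "p = (u, w)" and S: "S \<subseteq> W" "0 < f S" "u \<in> S" "w \<in> S"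
    by (auto simp: link_def)
  have "0 < f' S \<or> 0 < f' (insert v S)" using f'_sum[of S] S by linarith
  then show "p \<in> link (insert v W) f'"
  proof
    assume "0 < f' S"
    then show ?thesis unfolding link_def p using S by blast
  next
    assume "0 < f' (insert v S)"
    moreover have "insert v S \<in> Pow (insert v W)" using S by blast
    ultimately show ?thesis unfolding link_def p using S by blast
  qed
qed

text \<open>Old blocks stay connected by \<open>link_mono\<close>, and \<open>v\<close> reaches each
  block that is hit through an edge that has acquired \<open>v\<close>.\<close>

lemma connected':
  assumes conn: "\<forall>B\<in>P. \<forall>u\<in>B. \<forall>w\<in>B. (u, w) \<in> (link W f)\<^sup>*"
    and B: "B \<in> P'" "u \<in> B" "w \<in> B"
  shows "(u, w) \<in> (link (insert v W) f')\<^sup>*"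
proof -
  let ?R = "(link (insert v W) f')\<^sup>*"
  have old: "(u, w) \<in> ?R" if "B \<in> P" "u \<in> B" "w \<in> B" for u w B
    using conn that rtrancl_mono[OF link_mono] by blast
  have new: "(v, w) \<in> ?R" if w: "w \<in> merged" for w
  proof (cases "w = v")
    case False
    then obtain B where B: "B \<in> P" "w \<in> B" "0 < hits B" using w by (auto simp: merged_def)
    then obtain S where S: "S \<subseteq> W" "wing P S = B" "0 < x S" by (auto simp: hits_pos_iff)
    have "S \<noteq> {}" using S B block_ne by auto
    then obtain u where u: "u \<in> S" by blast
    have "0 < f S" using S x_le[of S] by simp
    then have "u \<in> B" using wing_block(2)[of S] \<open>S \<noteq> {}\<close> S u by auto
    have "insert v S \<in> Pow (insert v W)" "0 < f' (insert v S)" using S f'_new by auto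
    then have "(v, u) \<in> link (insert v W) f'" using u unfolding link_def by blast
    then show ?thesis using old[OF B(1) \<open>u \<in> B\<close> B(2)] by (rule converse_rtrancl_into_rtrancl)
  qed simp
  show ?thesis
  proof (cases "B = merged")
    case True
    have "(u, v) \<in> ?R" using new[of u] B True sym_rtrancl[OF sym_link] by (metis symD)
    then show ?thesis using new[of w] B True by (meson rtrancl_trans)
  next
    case False
    then show ?thesis using B old by (auto simp: P'_def)
  qed
qed

section \<open>Counting hinges, hits and pieces\<close>

lemma hinges_pos:
  assumes hinge: "\<forall>B\<in>P. \<exists>S. S \<subseteq> B \<and> S \<noteq> {} \<and> card S < h \<and> 0 < f S" and B: "B \<in> P"
  shows "1 \<le> c B"
proof -
  obtain S where S: "S \<subseteq> B" "S \<noteq> {}" "card S < h" "0 < f S" using hinge B by blast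
  then have "S \<in> {S\<in>Pow W. wing P S = B}" using wing_eq[OF part B] block_sub[OF B] by auto
  then have "0 < c B" unfolding hinges_def using S finW by (intro sum_pos2[of _ S]) auto
  then show ?thesis by simp
qed

lemma hinges_total: "f {} * h + (\<Sum>B\<in>P. c B) = r * m"
proof -
  have "r * m = (\<Sum>S\<in>Pow W. f S * (h - card S))"
    using total_hinges[OF finW inv] less card_le by simp
  also have "\<dots> = f {} * h + (\<Sum>B\<in>P. c B)"
    by (subst sum_by_wings[OF finW part supp]) (auto simp: hinges_def)
  finally show ?thesis by simp
qed

lemma hits_total: "x {} + (\<Sum>B\<in>P. hits B) = r"
proof -
  have "x S = 0" if "f S = 0" for S using x_le'[of S] that by simp
  from sum_by_wings[OF finW part supp, of x, OF this] show ?thesis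
    unfolding total hits_def by simp
qed

text \<open>If there is a block with at least two hinges or an edge with empty trace, it uses up the
  \<open>+ 1\<close> in the bound on pieces, so the blocks with one hinge account for at most
  \<open>(r - 1) * m\<close> of the \<open>r * m\<close> hinges. Otherwise all \<open>r * m\<close>
  hinges would belong to distinct pieces, which the bound excludes for
  \<open>m \<ge> 2\<close>.\<close>

lemma big_mass:
  assumes h: "2 \<le> h" and pos: "\<And>B. B \<in> P \<Longrightarrow> 1 \<le> c B"
    and count: "card P + f {} \<le> (r - 1) * m + 1" and m: "2 \<le> m" and r: "2 \<le> r"
  shows "m \<le> (\<Sum>S\<in>{S\<in>Pow W. wing P S = {} \<or> 2 \<le> c (wing P S)}. f S * (h - card S))"
proof -
  let ?big = "{B\<in>P. 2 \<le> c B}" and ?small = "{B\<in>P. \<not> 2 \<le> c B}"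
  let ?b = "\<lambda>S. wing P S = {} \<or> 2 \<le> c (wing P S)"
  let ?G = "\<Sum>S\<in>{S\<in>Pow W. ?b S}. f S * (h - card S)"
  have "?G = (\<Sum>S\<in>Pow W. if ?b S then f S * (h - card S) else 0)"
    using finW by (intro sum.inter_filter) simp
  also have "\<dots> = f {} * h + (\<Sum>B\<in>P. \<Sum>S\<in>{S\<in>Pow W. wing P S = B}. if ?b S then f S * (h - card S) else 0)"
    by (subst sum_by_wings[OF finW part supp]) auto
  also have "(\<Sum>B\<in>P. \<Sum>S\<in>{S\<in>Pow W. wing P S = B}. if ?b S then f S * (h - card S) else 0)
      = (\<Sum>B\<in>P. if 2 \<le> c B then c B else 0)"
  proof (intro sum.cong refl)
    fix B assume "B \<in> P"
    then have "B \<noteq> {}" using block_ne by blast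
    then show "(\<Sum>S\<in>{S\<in>Pow W. wing P S = B}. if ?b S then f S * (h - card S) else 0) = (if 2 \<le> c B then c B else 0)"
      by (auto simp: hinges_def intro!: sum.neutral sum.cong)
  qed
  also have "\<dots> = (\<Sum>B\<in>?big. c B)" using finP by (simp add: sum.inter_filter)
  finally have G: "?G = f {} * h + (\<Sum>B\<in>?big. c B)" .
  have PU: "P = ?big \<union> ?small" by auto
  have "(\<Sum>B\<in>P. c B) = (\<Sum>B\<in>?big. c B) + (\<Sum>B\<in>?small. c B)"
    using finP by (subst PU, intro sum.union_disjoint) auto
  also have "(\<Sum>B\<in>?small. c B) = (\<Sum>B\<in>?small. 1)"
    using pos by (intro sum.cong refl) (auto simp: not_le less_2_cases_iff dest!: pos)
  finally have tot: "?G + card ?small = r * m" using hinges_total G by simp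
  have "card P = card ?big + card ?small"
    using finP by (subst PU, intro card_Un_disjoint) auto
  then have q: "card ?big + card ?small + f {} \<le> (r - 1) * m + 1" using count by simp
  have rm: "r * m = (r - 1) * m + m" using r by (cases r) auto
  show ?thesis
  proof (cases "?big = {} \<and> f {} = 0")
    case True
    then have "?G = 0" using G by (simp only: sum.empty mult_0)
    then show ?thesis using tot q rm m True by simp
  next
    case False
    then have "1 \<le> card ?big + f {}" using finP by (cases "f {} = 0") (auto simp: Suc_le_eq card_gt_0_iff)
    then show ?thesis using tot q rm by linarith
  qed
qed

text \<open>A block without hits keeps its old trace with a hinge. For \<open>merged\<close>,
  \<open>big_hit\<close> supplies a trace \<open>S\<close> that is hit. If \<open>S\<close> is
  empty, the new trace \<open>{v}\<close> has a hinge because \<open>2 \<le> h\<close>. Otherwise a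
  block with at least two hinges is hit, and the rounding bound prevents all of its hinges from
  going to \<open>v\<close>.\<close>

lemma hinge':
  assumes h: "2 \<le> h" and r: "2 \<le> r"
    and hinge: "\<forall>B\<in>P. \<exists>S. S \<subseteq> B \<and> S \<noteq> {} \<and> card S < h \<and> 0 < f S"
    and count: "card P + f {} \<le> (r - 1) * m + 1" and m: "2 \<le> m" and B: "B \<in> P'"
  shows "\<exists>S. S \<subseteq> B \<and> S \<noteq> {} \<and> card S < h \<and> 0 < f' S"
proof (cases "B = merged")
  case False
  then have B: "B \<in> P" "hits B = 0" using B by (auto simp: P'_def)
  then obtain S where S: "S \<subseteq> B" "S \<noteq> {}" "card S < h" "0 < f S" using hinge by blast
  have "S \<subseteq> W" using S block_sub B by blast
  moreover have "wing P S = B" using wing_eq[OF part B(1)] S by blast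
  ultimately have "x S = 0" using B(2) hits_pos_iff[of B] by auto
  then show ?thesis using S \<open>S \<subseteq> W\<close> f'_old by (intro exI[of _ S]) auto
next
  case True
  have "0 < (\<Sum>S\<in>{S\<in>Pow W. wing P S = {} \<or> 2 \<le> c (wing P S)}. x S)"
    using big_hit big_mass[OF h hinges_pos[OF hinge] count m r] by blast
  then have "\<not> (\<forall>S\<in>{S\<in>Pow W. wing P S = {} \<or> 2 \<le> c (wing P S)}. x S = 0)"
    by (metis (no_types, lifting) less_irrefl sum.neutral)
  then obtain S where S: "S \<subseteq> W" "wing P S = {} \<or> 2 \<le> c (wing P S)" "0 < x S"
    by auto
  show ?thesis
  proof (cases "S = {}")
    case True
    then have "0 < f' {v}" using S f'_new[of "{}"] by simp
    then show ?thesis using h \<open>B = merged\<close> by (intro exI[of _ "{v}"]) (auto simp: merged_def)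
  next
    case False
    define C where "C = wing P S"
    have C: "C \<in> P" using wing_block(1)[of S] S x_le[of S] False by (simp add: C_def)
    then have c2: "2 \<le> c C" using S block_ne by (auto simp: C_def)
    have hit: "0 < hits C" using S by (auto simp: hits_pos_iff C_def)
    have "hits C < c C"
    proof (rule ccontr)
      assume "\<not> ?thesis"
      then have "m * c C \<le> m * hits C" by (intro mult_le_mono2) simp
      moreover have "m * hits C < c C + m" using wing_bound[OF C] unfolding hits_def .
      ultimately have "m * c C < c C + m" by linarith
      \<comment> \<open>For two numbers that are at least 2 the product is at least the sum.\<close>
      moreover obtain a b where "m = a + 2" "c C = b + 2" using m c2 by (metis add.commute le_Suc_ex)
      ultimately show False by (simp add: algebra_simps)
    qed
    then have "\<not> (\<forall>T\<in>{S\<in>Pow W. wing P S = C}. f T * (h - card T) \<le> x T)"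
      unfolding hits_def hinges_def not_le[symmetric] by (intro notI, elim notE) (blast intro: sum_mono)
    then obtain T where T: "T \<subseteq> W" "wing P T = C" "x T < f T * (h - card T)"
      by (auto simp: not_le)
    have "T \<noteq> {}" using T block_ne[OF C] by auto
    have fT: "0 < f T" using T by (cases "f T") auto
    have TC: "T \<subseteq> C" using wing_block(2)[OF fT \<open>T \<noteq> {}\<close>] T by simp
    have CM: "C \<subseteq> merged" using hit C by (auto simp: merged_def)
    \<comment> \<open>Either some edge with trace \<open>T\<close> does not acquire \<open>v\<close>
      and keeps its hinges, or all of them acquire it and, having had at least two hinges, retain
      one.\<close>
    show ?thesis
    proof (cases "x T < f T")
      case True
      then have "0 < f' T" using T f'_old by simp
      moreover have "card T < h" using T(3) by (cases "card T < h") auto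
      ultimately show ?thesis using TC CM \<open>T \<noteq> {}\<close> \<open>B = merged\<close> by (intro exI[of _ T]) auto
    next
      case False
      then have xT: "x T = f T" using x_le[OF T(1)] by simp
      then have "1 < h - card T" using T(3) by (cases "h - card T") auto
      then have "card (insert v T) < h"
        using finite_subset[OF T(1) finW] T(1) v by (subst card_insert_disjoint) auto
      moreover have "0 < f' (insert v T)" using f'_new T xT fT by simp
      moreover have "insert v T \<subseteq> B" using TC CM \<open>B = merged\<close> by (auto simp: merged_def)
      ultimately show ?thesis by blast
    qed
  qed
qed

text \<open>If every hit went to a different piece, the number of pieces would drop by \<open>r - 1\<close>. The
  excess hits \<open>L\<close> only occur in blocks with more than \<open>m\<close> hinges, and such blocks leave slack
  in the bound.\<close>

lemma count':
  assumes h: "2 \<le> h" and r: "2 \<le> r" and pos: "\<And>B. B \<in> P \<Longrightarrow> 1 \<le> c B"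
    and count: "card P + f {} \<le> (r - 1) * m + 1"
  shows "card P' + f' {} \<le> (r - 1) * (m - 1) + 1"
proof -
  let ?H = "{B\<in>P. 0 < hits B}" and ?N = "{B\<in>P. hits B = 0}"
  define L where "L = (\<Sum>B\<in>?H. hits B - 1)"
  have "merged \<notin> P" using v_notin_block by (auto simp: merged_def)
  then have cP': "card P' = card ?N + 1" using finP by (simp add: P'_def)
  have PU: "P = ?H \<union> ?N" by auto
  have cP: "card P = card ?H + card ?N"
    using finP by (subst PU, intro card_Un_disjoint) auto
  have "(\<Sum>B\<in>P. hits B) = (\<Sum>B\<in>?H. hits B)"
    using finP by (intro sum.mono_neutral_right) auto
  also have "\<dots> = (\<Sum>B\<in>?H. (hits B - 1) + 1)" by (intro sum.cong) auto
  also have "\<dots> = L + card ?H" unfolding L_def sum.distrib by simp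
  \<comment> \<open>Passing to \<open>P'\<close> removes \<open>card ?H\<close> blocks and
    \<open>x {}\<close> edges with empty trace and adds \<open>merged\<close>: a net loss of
    \<open>r - 1 - L\<close> pieces.\<close>
  finally have hitsum: "x {} + L + card ?H = r" using hits_total by simp
  \<comment> \<open>By the strict \<open>wing_bound\<close>, each hit beyond the first in a block
    requires \<open>m\<close> hinges there, and one further hinge is left for the block
    itself.\<close>
  have "m * L = (\<Sum>B\<in>?H. m * (hits B - 1))" by (simp add: L_def sum_distrib_left)
  also have "\<dots> \<le> (\<Sum>B\<in>?H. c B - 1)"
  proof (intro sum_mono)
    fix B assume "B \<in> ?H"
    then have "m * hits B < c B + m" "0 < hits B" using wing_bound by (auto simp: hits_def)
    then show "m * (hits B - 1) \<le> c B - 1" by (cases "hits B") auto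
  qed
  also have "\<dots> \<le> (\<Sum>B\<in>P. c B - 1)" using finP by (intro sum_mono2) auto
  finally have "m * L + card P \<le> (\<Sum>B\<in>P. (c B - 1) + 1)" unfolding sum.distrib by simp
  also have "\<dots> = (\<Sum>B\<in>P. c B)" using pos by (intro sum.cong refl) (simp add: Suc_le_eq)
  finally have "m * L + card P + f {} * h \<le> r * m" using hinges_total by simp
  moreover have "f {} \<le> f {} * h" using h by simp
  ultimately have mL: "m * L + card P + f {} \<le> r * m" by linarith
  have rm: "r * m = (r - 1) * m + m" using r by (cases r) auto
  have "card P + f {} + L \<le> (r - 1) * m + 1"
  proof (cases "L = 0")
    case False
    \<comment> \<open>In \<open>mL\<close>, all but one of the \<open>m\<close> copies of
      \<open>L \<ge> 1\<close> are traded for the \<open>m - 1\<close> by which \<open>r * m\<close>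
      exceeds the desired bound.\<close>
    obtain a where a: "m = Suc a" using less by (metis Suc_diff_Suc)
    have "a \<le> a * L" using False by simp
    then show ?thesis using mL rm unfolding a mult_Suc by linarith
  qed (use count in simp)
  moreover have "(r - 1) * m = (r - 1) * (m - 1) + (r - 1)" using less by (cases m) auto
  moreover have "f' {} + x {} = f {}" using f'_old[of "{}"] x_le[of "{}"] by simp
  ultimately show ?thesis using cP cP' hitsum r by linarith
qed

theorem colour_inv_step: "colour_inv n h r (insert v W) f' P'"
proof -
  have "(\<forall>B\<in>P'. \<forall>u\<in>B. \<forall>w\<in>B. (u, w) \<in> (link (insert v W) f')\<^sup>*) \<and>
        (card (insert v W) < n \<longrightarrow> (\<forall>B\<in>P'. \<exists>S. S \<subseteq> B \<and> S \<noteq> {} \<and> card S < h \<and> 0 < f' S)) \<and>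
        card P' + f' {} \<le> (r - 1) * (n - card (insert v W)) + 1" if hr: "2 \<le> h \<and> 2 \<le> r"
  proof -
    have conn: "\<forall>B\<in>P. \<forall>u\<in>B. \<forall>v\<in>B. (u, v) \<in> (link W f)\<^sup>*"
      and hinge: "\<forall>B\<in>P. \<exists>S. S \<subseteq> B \<and> S \<noteq> {} \<and> card S < h \<and> 0 < f S"
      and count: "card P + f {} \<le> (r - 1) * m + 1"
      using inv hr less by (auto simp: colour_inv_def)
    have cardW: "card (insert v W) = card W + 1" using finW v by simp
    show ?thesis
    proof (intro conjI ballI impI)
      show "(u, w) \<in> (link (insert v W) f')\<^sup>*" if "B \<in> P'" "u \<in> B" "w \<in> B" for B u w
        using connected'[OF conn that] .
      show "\<exists>S. S \<subseteq> B \<and> S \<noteq> {} \<and> card S < h \<and> 0 < f' S"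
        if "card (insert v W) < n" "B \<in> P'" for B
        using hinge'[OF _ _ hinge count _ that(2)] hr that(1) cardW by simp
      show "card P' + f' {} \<le> (r - 1) * (n - card (insert v W)) + 1"
        using count'[OF _ _ hinges_pos[OF hinge] count] hr by (simp add: cardW)
    qed
  qed
  moreover have "\<forall>S\<in>Pow (insert v W). S \<noteq> {} \<and> 0 < f' S \<longrightarrow> (\<exists>B\<in>P'. S \<subseteq> B)"
    using supp' by (intro ballI impI) (elim conjE)
  ultimately show ?thesis
    unfolding colour_inv_def by (intro conjI ballI degrees' size' part') simp_all
qed

end

section \<open>Detaching all vertices\<close>

text \<open>The last clause prescribes the multiplicity in the amalgamated complete hypergraph:
  \<open>l\<close> edges for every choice of the missing \<open>h - card S\<close> vertices among
  those not yet detached.\<close>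

definition detachment_state ::
  "nat \<Rightarrow> nat \<Rightarrow> nat \<Rightarrow> nat set \<Rightarrow> (nat \<Rightarrow> nat) \<Rightarrow> 'a set \<Rightarrow> (nat \<Rightarrow> 'a set \<Rightarrow> nat) \<Rightarrow>
   (nat \<Rightarrow> 'a set set) \<Rightarrow> bool" where
  "detachment_state n h l I r W f P \<longleftrightarrow>
     (\<forall>i\<in>I. colour_inv n h (r i) W (f i) (P i)) \<and>
     (\<forall>i\<in>I. \<forall>S. \<not> S \<subseteq> W \<longrightarrow> f i S = 0) \<and>
     (\<forall>S\<in>Pow W. (\<Sum>i\<in>I. f i S) =
        (if card S \<le> h then l * ((n - card W) choose (h - card S)) else 0))"

text \<open>The shares \<open>\<phi>\<close> are rounded by \<open>hierarchical_rounding\<close>,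
  with wings inside groups inside colours as the chain and traces as the further partition. The
  shares of a colour and of a trace add up to integers, so these sums are kept exactly.\<close>

lemma fair_split_exists:
  fixes f :: "nat \<Rightarrow> 'a set \<Rightarrow> nat"
  assumes W: "finite W" and I: "finite I" and less: "card W < n"
    and state: "detachment_state n h l I r W f P"
  defines "m \<equiv> n - card W"
  shows "\<exists>x :: nat \<Rightarrow> 'a set \<Rightarrow> nat.
    (\<forall>i\<in>I. \<forall>S. S \<subseteq> W \<longrightarrow> x i S \<le> f i S) \<and>
    (\<forall>i\<in>I. \<forall>S. \<not> S \<subseteq> W \<longrightarrow> x i S = 0) \<and>
    (\<forall>i\<in>I. (\<Sum>S\<in>Pow W. x i S) = r i) \<and>
    (\<forall>i\<in>I. \<forall>B. m * (\<Sum>S\<in>{S\<in>Pow W. wing (P i) S = B}. x i S) < hinges h W (f i) (P i) B + m) \<and>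
    (\<forall>i\<in>I. m \<le> (\<Sum>S\<in>{S\<in>Pow W. wing (P i) S = {} \<or> 2 \<le> hinges h W (f i) (P i) (wing (P i) S)}.
                    f i S * (h - card S)) \<longrightarrow>
       0 < (\<Sum>S\<in>{S\<in>Pow W. wing (P i) S = {} \<or> 2 \<le> hinges h W (f i) (P i) (wing (P i) S)}. x i S)) \<and>
    (\<forall>S\<in>Pow W. (\<Sum>i\<in>I. x i S) = (if card S < h then l * ((m - 1) choose (h - card S - 1)) else 0))"
proof -
  have m: "0 < m" using less by (simp add: m_def)
  have inv: "colour_inv n h (r i) W (f i) (P i)" if "i \<in> I" for i
    using state that by (simp add: detachment_state_def)
  have tot: "(\<Sum>i\<in>I. f i S) = (if card S \<le> h then l * (m choose (h - card S)) else 0)" if "S \<subseteq> W" for S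
    using state that by (simp add: detachment_state_def m_def)
  \<comment> \<open>A nonzero binomial coefficient means that an edge has at most \<open>m\<close>
    hinges; hence the share of a trace never exceeds its number of edges.\<close>
  have supp: "card S \<le> h" "h - card S \<le> m" if "i \<in> I" "S \<subseteq> W" "0 < f i S" for i S
  proof -
    have "0 < (\<Sum>i\<in>I. f i S)" using I that by (intro sum_pos2[of I i]) auto
    then show "card S \<le> h" "h - card S \<le> m"
      using tot[OF that(2)] by (auto split: if_splits simp: binomial_eq_0_iff intro: leI)
  qed
  define E where "E = I \<times> Pow W"
  define \<phi> :: "nat \<times> 'a set \<Rightarrow> real" where "\<phi> = (\<lambda>(i, S). real (f i S * (h - card S)) / real m)"
  define p where "p = (\<lambda>(i, S). (i :: nat, wing (P i) S))"
  \<comment> \<open>The flag singles out the group \<open>(i, True)\<close>, the junk wing together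
    with the blocks having at least two hinges, whose rounding gives \<open>big\<close>.\<close>
  define g where "g = (\<lambda>(i :: nat, B). (i, B = {} \<or> 2 \<le> hinges h W (f i) (P i) B))"
  have "finite E" using I W by (simp add: E_def)
  from hierarchical_rounding[OF this, of \<phi> p g fst snd] obtain z :: "nat \<times> 'a set \<Rightarrow> int" where
    z_elem: "\<forall>e\<in>E. \<lfloor>sum \<phi> {e}\<rfloor> \<le> sum z {e} \<and> sum z {e} \<le> \<lceil>sum \<phi> {e}\<rceil>" and
    z_wing: "\<forall>w. \<lfloor>sum \<phi> {e\<in>E. p e = w}\<rfloor> \<le> sum z {e\<in>E. p e = w} \<and> sum z {e\<in>E. p e = w} \<le> \<lceil>sum \<phi> {e\<in>E. p e = w}\<rceil>" and
    z_grp: "\<forall>k. \<lfloor>sum \<phi> {e\<in>E. g (p e) = k}\<rfloor> \<le> sum z {e\<in>E. g (p e) = k} \<and> sum z {e\<in>E. g (p e) = k} \<le> \<lceil>sum \<phi> {e\<in>E. g (p e) = k}\<rceil>" and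
    z_col: "\<forall>i. \<lfloor>sum \<phi> {e\<in>E. fst (g (p e)) = i}\<rfloor> \<le> sum z {e\<in>E. fst (g (p e)) = i} \<and> sum z {e\<in>E. fst (g (p e)) = i} \<le> \<lceil>sum \<phi> {e\<in>E. fst (g (p e)) = i}\<rceil>" and
    z_typ: "\<forall>t. \<lfloor>sum \<phi> {e\<in>E. snd e = t}\<rfloor> \<le> sum z {e\<in>E. snd e = t} \<and> sum z {e\<in>E. snd e = t} \<le> \<lceil>sum \<phi> {e\<in>E. snd e = t}\<rceil>"
    by (elim exE conjE) (rule that)
  have z_elem: "\<lfloor>\<phi> e\<rfloor> \<le> z e \<and> z e \<le> \<lceil>\<phi> e\<rceil>" if "e \<in> E" for e
    using z_elem that by simp
  define x where "x i S = (if S \<subseteq> W then nat (z (i, S)) else 0)" for i S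
  have z: "z (i, S) = int (x i S)" if "i \<in> I" "S \<subseteq> W" for i S
  proof -
    have "0 \<le> \<phi> (i, S)" by (simp add: \<phi>_def)
    then have "0 \<le> \<lfloor>\<phi> (i, S)\<rfloor>" by simp
    also have "\<dots> \<le> z (i, S)" using z_elem[of "(i, S)"] that by (simp add: E_def)
    finally show ?thesis using that by (simp add: x_def)
  qed
  have reindex: "sum \<psi> {e\<in>E. fst e = i \<and> Q (snd e)} = (\<Sum>S\<in>{S\<in>Pow W. Q S}. \<psi> (i, S))"
    if "i \<in> I" for i Q and \<psi> :: "nat \<times> 'a set \<Rightarrow> 'b::comm_monoid_add"
  proof (rule sum.reindex_cong)
    show "{e\<in>E. fst e = i \<and> Q (snd e)} = Pair i ` {S\<in>Pow W. Q S}"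
      using that by (auto simp: E_def)
  qed (auto simp: inj_on_def)
  have sum_z: "sum z {e\<in>E. fst e = i \<and> Q (snd e)} = int (\<Sum>S\<in>{S\<in>Pow W. Q S}. x i S)"
    if "i \<in> I" for i Q
    unfolding reindex[OF that] of_nat_sum using that by (intro sum.cong) (auto simp: z)
  have sum_\<phi>: "sum \<phi> {e\<in>E. fst e = i \<and> Q (snd e)} = real (\<Sum>S\<in>{S\<in>Pow W. Q S}. f i S * (h - card S)) / m"
    if "i \<in> I" for i Q
    unfolding reindex[OF that] by (simp add: \<phi>_def sum_divide_distrib)
  have elem: "x i S \<le> f i S" if iS: "i \<in> I" "S \<subseteq> W" for i S
  proof -
    have "f i S * (h - card S) \<le> f i S * m"
      using supp[OF iS] by (cases "f i S = 0") auto
    then have "real (f i S * (h - card S)) \<le> real (f i S) * real m"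
      by (metis of_nat_le_iff of_nat_mult)
    then have "\<phi> (i, S) \<le> real (f i S)" using m by (simp add: \<phi>_def pos_divide_le_eq)
    then have "\<lceil>\<phi> (i, S)\<rceil> \<le> int (f i S)" by (simp add: ceiling_le_iff)
    then show ?thesis using z_elem[of "(i, S)"] z[OF iS] iS by (simp add: E_def)
  qed
  have outside: "x i S = 0" if "\<not> S \<subseteq> W" for i S using that by (simp add: x_def)
  have colour: "(\<Sum>S\<in>Pow W. x i S) = r i" if i: "i \<in> I" for i
  proof -
    have eq: "{e\<in>E. fst (g (p e)) = i} = {e\<in>E. fst e = i \<and> True}" by (auto simp: p_def g_def)
    have all: "{S\<in>Pow W. True} = Pow W" by auto
    have "(\<Sum>S\<in>Pow W. f i S * (h - card S)) = r i * m"
      using total_hinges[OF W inv[OF i]] less supp(1)[OF i] by (simp add: m_def)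
    then have "sum \<phi> {e\<in>E. fst e = i \<and> True} = real (r i * m) / real m"
      using sum_\<phi>[OF i, of "\<lambda>_. True"] unfolding all by (simp only:)
    then have "sum \<phi> {e\<in>E. fst e = i \<and> True} = real (r i)" using m by simp
    then have "sum z {e\<in>E. fst e = i \<and> True} = int (r i)"
      using z_col[rule_format, of i] unfolding eq by simp
    then show ?thesis using sum_z[OF i, of "\<lambda>_. True"] unfolding all by (simp only: of_nat_eq_iff)
  qed
  have wing: "m * (\<Sum>S\<in>{S\<in>Pow W. wing (P i) S = B}. x i S) < hinges h W (f i) (P i) B + m"
    if i: "i \<in> I" for i B
  proof -
    let ?x = "\<Sum>S\<in>{S\<in>Pow W. wing (P i) S = B}. x i S"
    have eq: "{e\<in>E. p e = (i, B)} = {e\<in>E. fst e = i \<and> wing (P i) (snd e) = B}"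
      by (auto simp: p_def)
    have "int ?x \<le> \<lceil>real (hinges h W (f i) (P i) B) / m\<rceil>"
      using z_wing[rule_format, of "(i, B)"] sum_z[OF i, of "\<lambda>S. wing (P i) S = B"] sum_\<phi>[OF i, of "\<lambda>S. wing (P i) S = B"]
      unfolding eq hinges_def by simp
    then have "real_of_int (int ?x) \<le> real_of_int \<lceil>real (hinges h W (f i) (P i) B) / m\<rceil>"
      by (simp only: of_int_le_iff)
    then have "real ?x < real (hinges h W (f i) (P i) B) / m + 1"
      using ceiling_correct[of "real (hinges h W (f i) (P i) B) / m"] unfolding of_int_of_nat_eq by linarith
    then have "real m * real ?x < real (hinges h W (f i) (P i) B) + real m"
      using m by (simp add: field_simps)
    then show ?thesis by (metis of_nat_add of_nat_less_iff of_nat_mult)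
  qed
  have big: "0 < (\<Sum>S\<in>{S\<in>Pow W. Q S}. x i S)"
    if i: "i \<in> I" and Q: "Q = (\<lambda>S. wing (P i) S = {} \<or> 2 \<le> hinges h W (f i) (P i) (wing (P i) S))"
      and le: "m \<le> (\<Sum>S\<in>{S\<in>Pow W. Q S}. f i S * (h - card S))" for i Q
  proof -
    have eq: "{e\<in>E. g (p e) = (i, True)} = {e\<in>E. fst e = i \<and> Q (snd e)}"
      by (auto simp: p_def g_def Q)
    have "real m \<le> real (\<Sum>S\<in>{S\<in>Pow W. Q S}. f i S * (h - card S))" using le by (simp only: of_nat_le_iff)
    then have "1 \<le> sum \<phi> {e\<in>E. fst e = i \<and> Q (snd e)}"
      unfolding sum_\<phi>[OF i] using m by (simp add: pos_le_divide_eq)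
    then have "1 \<le> \<lfloor>sum \<phi> {e\<in>E. fst e = i \<and> Q (snd e)}\<rfloor>" by (simp only: one_le_floor)
    then have "1 \<le> int (\<Sum>S\<in>{S\<in>Pow W. Q S}. x i S)"
      using z_grp[rule_format, of "(i, True)"] unfolding eq sum_z[OF i] by linarith
    then show ?thesis by linarith
  qed
  have by_trace: "(\<Sum>i\<in>I. x i S) = (if card S < h then l * ((m - 1) choose (h - card S - 1)) else 0)" if S: "S \<subseteq> W" for S
  proof -
    define R where "R = (if card S < h then l * ((m - 1) choose (h - card S - 1)) else 0)"
    have img: "{e\<in>E. snd e = S} = (\<lambda>i. (i, S)) ` I" using S by (auto simp: E_def)
    \<comment> \<open>By \<open>(m choose Suc k) * Suc k = m * ((m - 1) choose k)\<close>, the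
      hinges of the edges with trace \<open>S\<close> are a multiple of \<open>m\<close>, so their
      \<open>m\<close>-th part is the integer \<open>R\<close>.\<close>
    have "(\<Sum>i\<in>I. f i S) * (h - card S) = m * R"
    proof (cases "card S < h")
      case True
      then obtain k where k: "h - card S = Suc k" by (metis Suc_diff_Suc)
      obtain m' where m': "m = Suc m'" using m by (cases m) auto
      have eq: "(m choose Suc k) * Suc k = m * (m' choose k)"
        using Suc_times_binomial_eq[of m' k] m' by (simp add: mult.commute)
      have a: "(\<Sum>i\<in>I. f i S) = l * (m choose Suc k)" using tot[OF S] True k by simp
      have b: "R = l * (m' choose k)" using True k m' by (simp add: R_def)
      show ?thesis unfolding a b k mult.assoc eq by (simp only: mult.left_commute)
    qed (simp add: R_def)
    then have "real ((\<Sum>i\<in>I. f i S) * (h - card S)) = real m * real R" by (simp only: of_nat_mult)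
    moreover have "sum \<phi> {e\<in>E. snd e = S} = real ((\<Sum>i\<in>I. f i S) * (h - card S)) / real m"
      unfolding img by (simp add: sum.reindex inj_on_def \<phi>_def sum_distrib_right flip: sum_divide_distrib)
    ultimately have "sum \<phi> {e\<in>E. snd e = S} = real R" using m by simp
    then have "sum z {e\<in>E. snd e = S} = int R" using z_typ[rule_format, of S] by simp
    moreover have "sum z {e\<in>E. snd e = S} = int (\<Sum>i\<in>I. x i S)"
      unfolding img using S by (simp add: sum.reindex inj_on_def z)
    ultimately show ?thesis unfolding R_def[symmetric] by (simp only: of_nat_eq_iff)
  qed
  show ?thesis
    by (intro exI[of _ x] conjI ballI allI impI)
      (assumption | rule elem outside colour wing big[OF _ refl] by_trace | erule PowD)+
qed

lemma detachment_state_step: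
  assumes W: "finite W" and I: "finite I" and less: "card W < n" and v: "v \<notin> W"
    and state: "detachment_state n h l I r W f P"
  shows "\<exists>f' P'. detachment_state n h l I r (insert v W) f' P'"
proof -
  define m where "m = n - card W"
  have cardW: "n - card (insert v W) = m - 1" using W v by (simp add: m_def)
  obtain m' where m': "m = Suc m'" using less by (cases m) (auto simp: m_def)
  from fair_split_exists[OF W I less state, folded m_def] obtain x where
    x_le: "\<forall>i\<in>I. \<forall>S. S \<subseteq> W \<longrightarrow> x i S \<le> f i S" and
    x_0: "\<forall>i\<in>I. \<forall>S. \<not> S \<subseteq> W \<longrightarrow> x i S = 0" and
    x_col: "\<forall>i\<in>I. (\<Sum>S\<in>Pow W. x i S) = r i" and
    x_wing: "\<forall>i\<in>I. \<forall>B. m * (\<Sum>S\<in>{S\<in>Pow W. wing (P i) S = B}. x i S) < hinges h W (f i) (P i) B + m" and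
    x_big: "\<forall>i\<in>I. m \<le> (\<Sum>S\<in>{S\<in>Pow W. wing (P i) S = {} \<or> 2 \<le> hinges h W (f i) (P i) (wing (P i) S)}.
                    f i S * (h - card S)) \<longrightarrow>
       0 < (\<Sum>S\<in>{S\<in>Pow W. wing (P i) S = {} \<or> 2 \<le> hinges h W (f i) (P i) (wing (P i) S)}. x i S)" and
    x_typ: "\<forall>S\<in>Pow W. (\<Sum>i\<in>I. x i S) = (if card S < h then l * ((m - 1) choose (h - card S - 1)) else 0)"
    by (elim exE conjE) (rule that)
  have f_0: "f i S = 0" if "i \<in> I" "\<not> S \<subseteq> W" for i S
    using state that by (simp add: detachment_state_def)
  have f_typ: "(\<Sum>i\<in>I. f i S) = (if card S \<le> h then l * (m choose (h - card S)) else 0)" if "S \<subseteq> W" for S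
    using state that by (simp add: detachment_state_def m_def)
  define f' where "f' i = split_vertex v (f i) (x i)" for i
  have "\<exists>Q. colour_inv n h (r i) (insert v W) (f' i) Q" if i: "i \<in> I" for i
  proof -
    interpret colour_step n h "r i" W "f i" "x i" "P i" v
    proof
      show "card S \<le> h" if "S \<subseteq> W" "0 < f i S" for S
      proof -
        have "0 < (\<Sum>i\<in>I. f i S)" using I that i by (intro sum_pos2[of I i]) auto
        then show ?thesis using f_typ[OF that(1)] by (auto split: if_splits)
      qed
      show "colour_inv n h (r i) W (f i) (P i)" using state i by (simp add: detachment_state_def)
    qed (use W v less x_le x_0 x_col x_wing x_big f_0 i in \<open>simp_all add: m_def\<close>)
    show ?thesis using colour_inv_step unfolding f'_def by blast
  qed
  then obtain P' where "\<forall>i\<in>I. colour_inv n h (r i) (insert v W) (f' i) (P' i)"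
    by metis
  moreover have "f' i S = 0" if "i \<in> I" "\<not> S \<subseteq> insert v W" for i S
  proof -
    have "\<not> S - {v} \<subseteq> W" "\<not> S \<subseteq> W" using that by auto
    then show ?thesis using that x_0 f_0 by (simp add: f'_def split_vertex_def)
  qed
  moreover have "(\<Sum>i\<in>I. f' i S) =
      (if card S \<le> h then l * ((n - card (insert v W)) choose (h - card S)) else 0)"
    if S: "S \<subseteq> insert v W" for S
  proof (cases "v \<in> S")
    case True
    define T where "T = S - {v}"
    have "finite T" using S W finite_subset[of S "insert v W"] by (simp add: T_def)
    moreover have "S = insert v T" "v \<notin> T" using True by (auto simp: T_def)
    ultimately have "card S = Suc (card T)" by simp
    moreover have "(\<Sum>i\<in>I. f' i S) = (\<Sum>i\<in>I. x i T)" using True by (simp add: f'_def split_vertex_def T_def)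
    moreover have "T \<subseteq> W" using S by (auto simp: T_def)
    ultimately show ?thesis using x_typ by (auto simp: cardW)
  next
    case False
    then have SW: "S \<subseteq> W" using S by blast
    then have sum: "(\<Sum>i\<in>I. f' i S) + (\<Sum>i\<in>I. x i S) = (\<Sum>i\<in>I. f i S)"
      unfolding sum.distrib[symmetric] using False x_le
      by (intro sum.cong) (auto simp: f'_def split_vertex_def)
    have x_typ: "(\<Sum>i\<in>I. x i S) = (if card S < h then l * (m' choose (h - card S - 1)) else 0)"
      using x_typ SW m' by simp
    consider "card S < h" | "card S = h" | "h < card S" by linarith
    then show ?thesis
    proof cases
      case 1
      then obtain k where k: "h - card S = Suc k" by (metis Suc_diff_Suc)
      \<comment> \<open>Pascal's rule: of the \<open>l * (m choose Suc k)\<close> edges,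
        \<open>l * (m' choose k)\<close> acquire \<open>v\<close>, and the rest is the count
        required for \<open>m' = m - 1\<close>.\<close>
      have "(\<Sum>i\<in>I. f' i S) + l * (m' choose k) = l * (m' choose Suc k) + l * (m' choose k)"
        using sum x_typ f_typ[OF SW] 1 k by (simp add: m' add_mult_distrib2)
      then show ?thesis using 1 by (simp add: cardW k m')
    next
      case 2
      then show ?thesis using sum x_typ f_typ[OF SW] by simp
    next
      case 3
      then show ?thesis using sum x_typ f_typ[OF SW] by simp
    qed
  qed
  ultimately have "detachment_state n h l I r (insert v W) f' P'"
    by (simp add: detachment_state_def)
  then show ?thesis by blast
qed

lemma detachment_state_exists:
  assumes V: "finite V" "card V = n" and h: "0 < h"
    and I: "finite I" and div: "\<forall>i\<in>I. h dvd r i * n" and sum: "(\<Sum>i\<in>I. r i) = l * ((n - 1) choose (h - 1))"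
  shows "\<exists>f P. detachment_state n h l I r V f P"
proof -
  have "\<exists>f P. detachment_state n h l I r W f P" if "W \<subseteq> V" for W
    using finite_subset[OF that V(1)] that
  proof (induction W rule: finite_induct)
    case empty
    \<comment> \<open>Before any detachment every edge is an \<open>h\<close>-fold loop at \<alpha>
      and has empty trace; divisibility makes the quotient exact.\<close>
    define f :: "nat \<Rightarrow> 'a set \<Rightarrow> nat" where "f i S = (if S = {} then r i * n div h else 0)" for i S
    have hf: "h * (r i * n div h) = r i * n" if "i \<in> I" for i using div that by simp
    have "colour_inv n h (r i) {} (f i) {}" if i: "i \<in> I" for i
    proof -
      \<comment> \<open>There are no blocks yet, so the bound on pieces concerns the loops alone.
        Their number is at most half of \<open>r i * n\<close>, and
        \<open>r i \<le> 2 * (r i - 1)\<close>.\<close>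
      have "r i * n div h \<le> (r i - 1) * n + 1" if h2: "2 \<le> h" and r2: "2 \<le> r i"
      proof -
        obtain s where s: "r i = 2 + s" using le_Suc_ex[OF r2] by blast
        have "2 * (r i * n div h) \<le> h * (r i * n div h)" using h2 by (intro mult_le_mono1)
        also have "\<dots> = 2 * n + s * n" using hf[OF i] s by (simp add: add_mult_distrib)
        finally have "r i * n div h \<le> n + s * n" by linarith
        also have "\<dots> = (r i - 1) * n" by (simp add: s)
        finally show ?thesis by linarith
      qed
      then show ?thesis using hf[OF i] by (simp add: colour_inv_def f_def partition_on_def)
    qed
    moreover have "(\<Sum>i\<in>I. f i {}) = l * (n choose h)"
    proof -
      \<comment> \<open>Multiplied by \<open>h\<close>, the claim counts incidences:
        \<open>n\<close> vertices, each of degree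
        \<open>l * ((n - 1) choose (h - 1))\<close>.\<close>
      have "h * (\<Sum>i\<in>I. f i {}) = (\<Sum>i\<in>I. r i * n)"
        by (simp add: f_def sum_distrib_left hf)
      also have "\<dots> = l * (n * ((n - 1) choose (h - 1)))"
        by (simp add: sum flip: sum_distrib_right)
      also have "\<dots> = h * (l * (n choose h))"
        using times_binomial_minus1_eq[OF h, of n] by (simp add: mult_ac)
      finally show ?thesis using h by simp
    qed
    ultimately have "detachment_state n h l I r {} f (\<lambda>_. {})"
      by (auto simp: detachment_state_def f_def)
    then show ?case by blast
  next
    case (insert v W)
    then obtain f P where "detachment_state n h l I r W f P" by auto
    moreover have "W \<subset> V" using insert by auto
    then have "card W < n" using psubset_card_mono[OF V(1)] V(2) by simp
    ultimately show ?case using detachment_state_step insert I by metis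
  qed
  then show ?thesis by blast
qed

section \<open>Factorizations of the complete hypergraph\<close>

definition edges_of :: "'a set \<Rightarrow> ('a set \<Rightarrow> nat) \<Rightarrow> 'a multiset multiset" where
  "edges_of V f = (\<Sum>S\<in>Pow V. replicate_mset (f S) (mset_set S))"

lemma set_mset_edges_of:
  "finite V \<Longrightarrow> set_mset (edges_of V f) = mset_set ` {S\<in>Pow V. 0 < f S}"
  unfolding edges_of_def by (subst set_mset_sum) (auto split: if_splits)

lemma sum_mset_edges_of:
  fixes g :: "'a multiset \<Rightarrow> nat"
  shows "(\<Sum>e\<in>#edges_of V f. g e) = (\<Sum>S\<in>Pow V. f S * g (mset_set S))"
proof -
  have "(\<Sum>e\<in>#(\<Sum>S\<in>A. replicate_mset (f S) (mset_set S)). g e) = (\<Sum>S\<in>A. f S * g (mset_set S))" for A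
    by (induction A rule: infinite_finite_induct) simp_all
  then show ?thesis by (simp add: edges_of_def)
qed

lemma sum_edges_of:
  assumes "finite V"
  shows "(\<Sum>i\<in>I. edges_of V (f i)) = edges_of V (\<lambda>S. \<Sum>i\<in>I. f i S)"
proof -
  have "(\<Sum>i\<in>I. replicate_mset (k i) e) = replicate_mset (\<Sum>i\<in>I. k i) e"
    for k :: "_ \<Rightarrow> nat" and e :: "'a multiset"
    by (rule multiset_eqI) (simp add: count_sum)
  then show ?thesis unfolding edges_of_def by (subst sum.swap) simp
qed

lemma complete_hypergraph_edges_of:
  assumes "finite V"
  shows "snd (complete_hypergraph l h V) = edges_of V (\<lambda>S. if card S = h then l else 0)"
proof -
  have "repeat_mset l (image_mset mset_set (mset_set A)) = (\<Sum>S\<in>A. replicate_mset l (mset_set S))"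
    if "finite A" for A :: "'a set set"
    using that by (induction A rule: finite_induct) (simp_all add: repeat_mset_distrib2)
  then have "snd (complete_hypergraph l h V) = (\<Sum>S\<in>{S\<in>Pow V. card S = h}. replicate_mset l (mset_set S))"
    using assms by (simp add: complete_hypergraph_def)
  also have "\<dots> = edges_of V (\<lambda>S. if card S = h then l else 0)"
    unfolding edges_of_def using assms by (intro sum.mono_neutral_cong_left) auto
  finally show ?thesis .
qed

lemma fst_complete_hypergraph [simp]: "fst (complete_hypergraph l h V) = V"
  by (simp add: complete_hypergraph_def)

lemma is_hypergraph_complete:
  assumes "finite V" shows "is_hypergraph (complete_hypergraph l h V)"
proof -
  have "set_mset (mset_set S) \<subseteq> V" if "S \<subseteq> V" for S
    using that assms by (simp add: finite_subset)
  then show ?thesis using assms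
    by (auto simp: is_hypergraph_def complete_hypergraph_edges_of set_mset_edges_of)
qed

lemma is_factorizationI:
  assumes V: "finite V" and sum: "(\<Sum>i = 1..k. F i) = snd (complete_hypergraph l h V)"
    and deg: "\<And>i u. i \<in> {1..k} \<Longrightarrow> u \<in> V \<Longrightarrow> (\<Sum>e\<in>#F i. count e u) = r i"
  shows "is_factorization k r F (complete_hypergraph l h V)"
proof -
  have sub: "F i \<subseteq># snd (complete_hypergraph l h V)" if "i \<in> {1..k}" for i
    unfolding sum[symmetric] sum.remove[OF finite_atLeastAtMost that] by simp
  have "is_hypergraph (V, F i)" if "i \<in> {1..k}" for i
    using is_hypergraph_complete[OF V, of l h] mset_subset_eqD[OF sub[OF that]]
    by (auto simp: is_hypergraph_def)
  then show ?thesis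
    using sum deg sub is_hypergraph_complete[OF V, of l h]
    by (simp add: is_factorization_def is_factor_def spanning_subhypergraph_def hdegree_def)
qed

text \<open>With all vertices detached, the bound on pieces reads
  \<open>card P + f {} \<le> 1\<close>. All vertices then share one block, and a chain of
  \<open>link\<close> steps is a walk along edges.\<close>

lemma detached_connected:
  assumes V: "finite V" "card V = n" and inv: "colour_inv n h r V f P" and hr: "2 \<le> h" "2 \<le> r"
  shows "hconnected (V, edges_of V f)"
  unfolding hconnected_def fst_conv snd_conv
proof (intro ballI)
  fix u v assume uv: "u \<in> V" "v \<in> V"
  have part: "partition_on V P" and conn: "\<forall>B\<in>P. \<forall>u\<in>B. \<forall>v\<in>B. (u, v) \<in> (link V f)\<^sup>*"
    and "card P \<le> 1"
    using inv hr V by (auto simp: colour_inv_def)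
  moreover have "finite P" using finite_elements[OF V(1) part] .
  ultimately have single: "\<forall>A\<in>P. \<forall>B\<in>P. A = B" using card_le_Suc0_iff_eq[of P] by simp
  obtain A B where "A \<in> P" "u \<in> A" "B \<in> P" "v \<in> B"
    using uv part by (auto simp: partition_on_def)
  then have "(u, v) \<in> (link V f)\<^sup>*" using conn single by blast
  then obtain t where "(u, v) \<in> link V f ^^ t" by (auto dest: rtrancl_imp_relpow)
  then obtain w where w: "w 0 = u" "w t = v" and step: "\<forall>j<t. (w j, w (Suc j)) \<in> link V f"
    unfolding relpow_fun_conv by blast
  have edge: "\<exists>e\<in>#edges_of V f. w j \<in># e \<and> w (Suc j) \<in># e" and inV: "w j \<in> V" if j: "j < t" for j
  proof -
    obtain S where S: "S \<in> Pow V" "0 < f S" "w j \<in> S" "w (Suc j) \<in> S"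
      using step j unfolding link_def by blast
    then have "finite S" using V(1) finite_subset by auto
    then show "\<exists>e\<in>#edges_of V f. w j \<in># e \<and> w (Suc j) \<in># e"
      using S by (intro bexI[of _ "mset_set S"]) (auto simp: set_mset_edges_of[OF V(1)])
    show "w j \<in> V" using S by auto
  qed
  have "w j \<in> V" if "j \<le> t" for j using inV[of j] that w uv by (cases "j = t") auto
  then show "\<exists>(t :: nat) w. w 0 = u \<and> w t = v \<and> (\<forall>j \<le> t. w j \<in> V) \<and>
     (\<forall>j < t. \<exists>e \<in># edges_of V f. w j \<in># e \<and> w (Suc j) \<in># e)"
    using w edge by (intro exI[of _ t] exI[of _ w]) blast
qed

lemma connected_factorization_exists:
  assumes V: "finite V" "card V = n" and h: "0 < h"
    and div: "\<forall>i\<in>{1..k}. h dvd r i * n" and sum: "(\<Sum>i = 1..k. r i) = l * ((n - 1) choose (h - 1))"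
  shows "\<exists>F. is_factorization k r F (complete_hypergraph l h V) \<and>
           (2 \<le> h \<longrightarrow> (\<forall>i\<in>{1..k}. 2 \<le> r i \<longrightarrow> hconnected (V, F i)))"
proof -
  obtain f P where state: "detachment_state n h l {1..k} r V f P"
    using detachment_state_exists[OF V h _ div sum] by auto
  define F where "F i = edges_of V (f i)" for i
  have inv: "colour_inv n h (r i) V (f i) (P i)" if "i \<in> {1..k}" for i
    using state that by (simp add: detachment_state_def)
  have "is_factorization k r F (complete_hypergraph l h V)"
  proof (rule is_factorizationI[OF V(1)])
    \<comment> \<open>No vertex is left to detach, so the factor
      \<open>0 choose (h - card S)\<close> leaves only the \<open>h\<close>-subsets, each with
      multiplicity \<open>l\<close>.\<close>
    have "(\<Sum>i = 1..k. f i S) = (if card S = h then l else 0)" if "S \<in> Pow V" for S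
      using state that V by (auto simp: detachment_state_def binomial_eq_0)
    then show "(\<Sum>i = 1..k. F i) = snd (complete_hypergraph l h V)"
      unfolding F_def sum_edges_of[OF V(1)] complete_hypergraph_edges_of[OF V(1)]
      unfolding edges_of_def by (intro sum.cong) simp_all
  next
    fix i u assume i: "i \<in> {1..k}" and u: "u \<in> V"
    have "(\<Sum>e\<in>#F i. count e u) = (\<Sum>S\<in>Pow V. of_bool (u \<in> S) * f i S)"
      unfolding F_def sum_mset_edges_of using V(1)
      by (intro sum.cong) (auto simp: count_mset_set' dest: finite_subset)
    then show "(\<Sum>e\<in>#F i. count e u) = r i" using inv[OF i] u by (simp add: colour_inv_def)
  qed
  moreover have "hconnected (V, F i)" if "2 \<le> h" "i \<in> {1..k}" "2 \<le> r i" for i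
    using detached_connected[OF V inv] that by (simp add: F_def)
  ultimately show ?thesis by blast
qed

section \<open>Necessity of the conditions by counting incidences\<close>

lemma card_subsets_containing:
  assumes "finite V" "v \<in> V" "0 < h"
  shows "card {S. S \<subseteq> V \<and> card S = h \<and> v \<in> S} = (card V - 1) choose (h - 1)"
proof -
  have "bij_betw (insert v) {T. T \<subseteq> V - {v} \<and> card T = h - 1} {S. S \<subseteq> V \<and> card S = h \<and> v \<in> S}"
  proof (rule bij_betw_byWitness[where f' = "\<lambda>S. S - {v}"])
    show "insert v ` {T. T \<subseteq> V - {v} \<and> card T = h - 1} \<subseteq> {S. S \<subseteq> V \<and> card S = h \<and> v \<in> S}"
    proof (rule image_subsetI)
      fix T assume T: "T \<in> {T. T \<subseteq> V - {v} \<and> card T = h - 1}"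
      then have "finite T" "v \<notin> T" using assms(1) finite_subset[of T V] by auto
      then show "insert v T \<in> {S. S \<subseteq> V \<and> card S = h \<and> v \<in> S}" using T assms by auto
    qed
    show "(\<lambda>S. S - {v}) ` {S. S \<subseteq> V \<and> card S = h \<and> v \<in> S} \<subseteq> {T. T \<subseteq> V - {v} \<and> card T = h - 1}"
      by auto
  qed auto
  then have "card {S. S \<subseteq> V \<and> card S = h \<and> v \<in> S} = card {T. T \<subseteq> V - {v} \<and> card T = h - 1}"
    by (rule bij_betw_same_card[symmetric])
  also have "\<dots> = card (V - {v}) choose (h - 1)" using assms by (intro n_subsets) simp
  finally show ?thesis using assms by simp
qed

lemma hdegree_complete_hypergraph:
  assumes "finite V" "v \<in> V" "0 < h"
  shows "hdegree (complete_hypergraph l h V) v = l * ((card V - 1) choose (h - 1))"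
proof -
  have "hdegree (complete_hypergraph l h V) v
      = (\<Sum>S\<in>Pow V. (if card S = h then l else 0) * count (mset_set S) v)"
    unfolding hdegree_def complete_hypergraph_edges_of[OF assms(1)] sum_mset_edges_of ..
  also have "\<dots> = (\<Sum>S\<in>{S. S \<subseteq> V \<and> card S = h \<and> v \<in> S}. l)"
    using assms(1) by (intro sum.mono_neutral_cong_right) (auto simp: count_mset_set' dest: finite_subset)
  finally show ?thesis using card_subsets_containing[OF assms] by simp
qed

lemma sum_degrees_uniform:
  assumes "finite V" "\<And>e. e \<in># M \<Longrightarrow> set_mset e \<subseteq> V \<and> size e = h"
  shows "(\<Sum>v\<in>V. \<Sum>e\<in>#M. count e v) = h * size M"
  using assms(2)
proof (induction M)
  case (add e M)
  have "(\<Sum>v\<in>V. count e v) = size e"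
    unfolding size_multiset_overloaded_eq using assms(1) add.prems[of e]
    by (intro sum.mono_neutral_right) (auto simp: not_in_iff)
  then show ?case using add by (simp add: sum.distrib)
qed simp

text \<open>Incidences of \<open>F i\<close> number \<open>r i * n\<close> by vertices and
  \<open>h * size (F i)\<close> by edges, which gives divisibility. At one vertex the degrees in the
  factors add up to its degree in the complete hypergraph.\<close>

lemma factorization_necessary:
  assumes V: "finite V" "card V = n" and n: "0 < n" and h: "0 < h"
    and fact: "is_factorization k r F (complete_hypergraph l h V)"
  shows "(\<forall>i\<in>{1..k}. h dvd r i * n) \<and> (\<Sum>i = 1..k. r i) = l * ((n - 1) choose (h - 1))"
proof
  have sum: "(\<Sum>i = 1..k. F i) = snd (complete_hypergraph l h V)"
    and sub: "F i \<subseteq># snd (complete_hypergraph l h V)"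
    and deg: "\<forall>v\<in>V. (\<Sum>e\<in>#F i. count e v) = r i" if "i \<in> {1..k}" for i
    using fact that
    by (auto simp: is_factorization_def is_factor_def spanning_subhypergraph_def hdegree_def)
  show "\<forall>i\<in>{1..k}. h dvd r i * n"
  proof
    fix i assume i: "i \<in> {1..k}"
    have "set_mset e \<subseteq> V \<and> size e = h" if e: "e \<in># F i" for e
    proof -
      obtain S where S: "e = mset_set S" "S \<subseteq> V" "card S = h"
        using mset_subset_eqD[OF sub[OF i] e] V(1)
        by (auto simp: complete_hypergraph_edges_of set_mset_edges_of split: if_splits)
      then show ?thesis using finite_subset[OF S(2) V(1)] by simp
    qed
    then have "(\<Sum>v\<in>V. \<Sum>e\<in>#F i. count e v) = h * size (F i)"
      by (rule sum_degrees_uniform[OF V(1)])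
    moreover have "(\<Sum>v\<in>V. \<Sum>e\<in>#F i. count e v) = (\<Sum>v\<in>V. r i)"
      using deg[OF i] by (intro sum.cong) auto
    ultimately have "r i * n = h * size (F i)" using V(2) by (simp add: mult.commute)
    then show "h dvd r i * n" by simp
  qed
  obtain v where v: "v \<in> V" using n V by fastforce
  have "(\<Sum>i\<in>A. \<Sum>e\<in>#F i. count e v) = (\<Sum>e\<in>#(\<Sum>i\<in>A. F i). count e v)" for A
    by (induction A rule: infinite_finite_induct) simp_all
  moreover have "(\<Sum>i = 1..k. r i) = (\<Sum>i = 1..k. \<Sum>e\<in>#F i. count e v)"
    using deg v by (intro sum.cong) auto
  ultimately have "(\<Sum>i = 1..k. r i) = (\<Sum>e\<in>#(\<Sum>i = 1..k. F i). count e v)" by simp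
  also have "\<dots> = hdegree (complete_hypergraph l h V) v"
    using fact by (simp add: is_factorization_def hdegree_def)
  finally show "(\<Sum>i = 1..k. r i) = l * ((n - 1) choose (h - 1))"
    using hdegree_complete_hypergraph[OF V(1) v h] V(2) by simp
qed

text \<open>The connectedness clause is restricted to \<open>h \<ge> 2\<close> because
  \<open>uniform_1_factor_not_connected\<close> refutes it for \<open>h = 1\<close> on two or more
  vertices.\<close>

theorem theorem1p2:
  fixes V :: "'a set" and n h l k :: nat and r :: "nat \<Rightarrow> nat"
  assumes "finite V" and "card V = n"
    and "n > 0" and "h > 0" and "l > 0" and "k > 0"
    and "\<forall>i \<in> {1..k}. r i > 0"
    and "n > h"
  shows "(factorizable k r (complete_hypergraph l h V) \<longleftrightarrow>
            (\<forall>i \<in> {1..k}. h dvd r i * n) \<and> (\<Sum>i = 1..k. r i) = l * ((n - 1) choose (h - 1)))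
       \<and> (h \<ge> 2 \<and> (\<forall>i \<in> {1..k}. h dvd r i * n) \<and>
            (\<Sum>i = 1..k. r i) = l * ((n - 1) choose (h - 1)) \<longrightarrow>
            (\<exists>F. is_factorization k r F (complete_hypergraph l h V) \<and>
                 (\<forall>i \<in> {1..k}. r i \<ge> 2 \<longrightarrow> hconnected (V, F i))))"
  using connected_factorization_exists[OF assms(1,2,4), of k r l]
    factorization_necessary[OF assms(1-4), of k r _ l]
  unfolding factorizable_def by blast

end
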